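(* Let $(M_n,g)$, $n>2$, be an $n$-dimensional Riemannian manifold with a unit vector field $\xi$ that is parallel with respect to the Levi-Civita connection $\nabla$, and let $\tilde\nabla$ be the projective semi-symmetric connection determined by $\pi=g(\cdot,\xi)$. If $\tilde R.\tilde P=0$, then $(M_n,g)$ is Ricci flat with respect to the Levi-Civita connection, i.e. $S=0$.
   Context: $(M_n,g)$ is an $n$-dimensional Riemannian manifold with Levi-Civita connection $\nabla$; $\xi$ is a vector field with $g(\xi,\xi)=1$ and $\pi(X)=g(X,\xi)$. The projective semi-symmetric connection $\tilde\nabla$ is the linear connection $$\tilde\nabla_XY=\nabla_XY+\psi(Y)X+\psi(X)Y+\phi(Y)X-\phi(X)Y,\qquad \phi=\tfrac12\pi,\quad \psi=\tfrac{n-1}{2(n+1)}\pi ;$$ its torsion is $\tilde T(X,Y)=\pi(Y)X-\pi(X)Y$. $R$ and $\tilde R$ are the curvature tensors of $\nabla$ and $\tilde\nabla$, with $R(X,Y)Z=\nabla_X\nabla_YZ-\nabla_Y\nabla_XZ-\nabla_{[X,Y]}Z$ and likewise for $\tilde R$. The Ricci tensors are $S(Y,Z)=\mathrm{tr}(X\mapsto R(X,Y)Z)$ and $\tilde S(Y,Z)=\mathrm{tr}(X\mapsto\tilde R(X,Y)Z)$. The Weyl projective curvature tensor of $\tilde\nabla$ is $\tilde P(X,Y)Z=\tilde R(X,Y)Z-\frac{1}{n-1}\{\tilde S(Y,Z)X-\tilde S(X,Z)Y\}$. The condition $\tilde R.\tilde P=0$ means that for all vector fields $X,Y,Z,U,V$,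 $$\tilde R(X,Y)\tilde P(Z,U)V-\tilde P(\tilde R(X,Y)Z,U)V-\tilde P(Z,\tilde R(X,Y)U)V-\tilde P(Z,U)\tilde R(X,Y)V=0.$$ *)

theory Defs
  imports "HOL-Analysis.Analysis" "HOL-Library.Function_Algebras"
begin

text \<open>Functions into a real vector space form a real vector space pointwise. Tangent vectors
  (operators on functions) and vector fields (functions into tangent vectors) get their linear
  structure from here.\<close>

instantiation "fun" :: (type, real_vector) real_vector
begin

definition scaleR_fun_def: "scaleR c f = (\<lambda>x. c *\<^sub>R f x)"

instance
  by standard (simp_all add: scaleR_fun_def fun_eq_iff scaleR_add_right scaleR_add_left)

end


section \<open>Smooth manifolds\<close>

text \<open>The following two notions are only used for open sets in Euclidean space, where
  \<open>f\<close> is of class \<open>C\<close>-\<open>(k+1)\<close> iff it is differentiable and all its directional derivatives are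
  of class \<open>C\<close>-\<open>k\<close>.\<close>

primrec Ck_on :: "nat \<Rightarrow> 'v::real_normed_vector set \<Rightarrow> ('v \<Rightarrow> 'w::real_normed_vector) \<Rightarrow> bool"
  where
  "Ck_on 0 S f \<longleftrightarrow> continuous_on S f"
| "Ck_on (Suc k) S f \<longleftrightarrow> (\<forall>x\<in>S. f differentiable (at x)) \<and>
     (\<forall>v. Ck_on k S (\<lambda>x. frechet_derivative f (at x) v))"

definition Cinf_on :: "'v::real_normed_vector set \<Rightarrow> ('v \<Rightarrow> 'w::real_normed_vector) \<Rightarrow> bool" where
  "Cinf_on S f \<longleftrightarrow> (\<forall>k. Ck_on k S f)"

text \<open>A chart is a pair of its domain and its coordinate map. The manifold is the whole type
  \<open>'a\<close>, and its dimension is the cardinality of the index type \<open>'n\<close>.\<close>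

type_synonym ('a, 'n) chart = "'a set \<times> ('a \<Rightarrow> real ^ 'n)"

definition is_chart :: "('a::topological_space, 'n::finite) chart \<Rightarrow> bool" where
  "is_chart c \<longleftrightarrow> (case c of (U, x) \<Rightarrow>
     open U \<and> open (x ` U) \<and> homeomorphism U (x ` U) x (inv_into U x))"

definition smooth_atlas ::
  "('a::{t2_space, second_countable_topology}, 'n::finite) chart set \<Rightarrow> bool" where
  "smooth_atlas A \<longleftrightarrow>
     (\<forall>c\<in>A. is_chart c) \<and> (\<Union>c\<in>A. fst c) = UNIV \<and>
     (\<forall>(U, x)\<in>A. \<forall>(V, y)\<in>A. Cinf_on (x ` (U \<inter> V)) (y \<circ> inv_into U x))"

definition mdim :: "('a, 'n::finite) chart set \<Rightarrow> nat" where
  "mdim A = CARD('n)"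

definition smooth_funs :: "('a, 'n::finite) chart set \<Rightarrow> ('a \<Rightarrow> real) set" where
  "smooth_funs A = {f. \<forall>(U, x)\<in>A. Cinf_on (x ` U) (f \<circ> inv_into U x)}"

text \<open>Tangent vectors at \<open>p\<close> are the operators \<open>f \<mapsto> \<Sum>\<^sub>i w\<^sub>i (\<partial>f/\<partial>x\<^sub>i)(p)\<close> on smooth functions, where
  \<open>x\<close> is a chart around \<open>p\<close>. They are set to \<open>0\<close> on functions that are not smooth, so that
  equality of tangent vectors is equality of functions.\<close>

type_synonym 'a tvec = "('a \<Rightarrow> real) \<Rightarrow> real"

definition chart_tvec :: "('a, 'n::finite) chart set \<Rightarrow> ('a, 'n) chart \<Rightarrow> 'a \<Rightarrow> real ^ 'n \<Rightarrow> 'a tvec"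
  where
  "chart_tvec A c p w = (\<lambda>f. if f \<in> smooth_funs A
     then frechet_derivative (f \<circ> inv_into (fst c) (snd c)) (at (snd c p)) w else 0)"

definition tangent_space :: "('a, 'n::finite) chart set \<Rightarrow> 'a \<Rightarrow> 'a tvec set" where
  "tangent_space A p = {chart_tvec A c p w | c w. c \<in> A \<and> p \<in> fst c}"

type_synonym 'a vfield = "'a \<Rightarrow> 'a tvec"

definition deriv_along :: "'a vfield \<Rightarrow> ('a \<Rightarrow> real) \<Rightarrow> 'a \<Rightarrow> real" where
  "deriv_along X f = (\<lambda>p. X p f)"

definition vector_fields :: "('a, 'n::finite) chart set \<Rightarrow> 'a vfield set" where
  "vector_fields A = {X. (\<forall>p. X p \<in> tangent_space A p) \<and>
     (\<forall>f\<in>smooth_funs A. deriv_along X f \<in> smooth_funs A)}"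

definition fmult :: "('a \<Rightarrow> real) \<Rightarrow> 'a vfield \<Rightarrow> 'a vfield" (infixr "\<odot>" 75) where
  "f \<odot> X = (\<lambda>p. f p *\<^sub>R X p)"

definition lie_bracket :: "'a vfield \<Rightarrow> 'a vfield \<Rightarrow> 'a vfield" where
  "lie_bracket X Y = (\<lambda>p f. X p (deriv_along Y f) - Y p (deriv_along X f))"


section \<open>Riemannian metrics and linear connections\<close>

type_synonym 'a metric = "'a \<Rightarrow> 'a tvec \<Rightarrow> 'a tvec \<Rightarrow> real"

definition metric_app :: "'a metric \<Rightarrow> 'a vfield \<Rightarrow> 'a vfield \<Rightarrow> 'a \<Rightarrow> real" where
  "metric_app g X Y = (\<lambda>p. g p (X p) (Y p))"

definition riemannian_metric :: "('a, 'n::finite) chart set \<Rightarrow> 'a metric \<Rightarrow> bool" where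
  "riemannian_metric A g \<longleftrightarrow>
     (\<forall>p. \<forall>u\<in>tangent_space A p. \<forall>v\<in>tangent_space A p. \<forall>w\<in>tangent_space A p. \<forall>a b.
        g p (a *\<^sub>R u + b *\<^sub>R v) w = a * g p u w + b * g p v w) \<and>
     (\<forall>p. \<forall>u\<in>tangent_space A p. \<forall>v\<in>tangent_space A p. g p u v = g p v u) \<and>
     (\<forall>p. \<forall>u\<in>tangent_space A p. u \<noteq> 0 \<longrightarrow> g p u u > 0) \<and>
     (\<forall>X\<in>vector_fields A. \<forall>Y\<in>vector_fields A. metric_app g X Y \<in> smooth_funs A)"

definition riemannian_manifold ::
  "('a::{t2_space, second_countable_topology}, 'n::finite) chart set \<Rightarrow> 'a metric \<Rightarrow> bool" where
  "riemannian_manifold A g \<longleftrightarrow> smooth_atlas A \<and> riemannian_metric A g"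

type_synonym 'a connection = "'a vfield \<Rightarrow> 'a vfield \<Rightarrow> 'a vfield"

definition linear_connection :: "('a, 'n::finite) chart set \<Rightarrow> 'a connection \<Rightarrow> bool" where
  "linear_connection A D \<longleftrightarrow>
     (\<forall>X\<in>vector_fields A. \<forall>Y\<in>vector_fields A. D X Y \<in> vector_fields A) \<and>
     (\<forall>X\<in>vector_fields A. \<forall>Y\<in>vector_fields A. \<forall>Z\<in>vector_fields A.
        D (X + Y) Z = D X Z + D Y Z \<and> D X (Y + Z) = D X Y + D X Z) \<and>
     (\<forall>f\<in>smooth_funs A. \<forall>X\<in>vector_fields A. \<forall>Y\<in>vector_fields A.
        D (f \<odot> X) Y = f \<odot> D X Y \<and> D X (f \<odot> Y) = deriv_along X f \<odot> Y + f \<odot> D X Y)"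

definition levi_civita :: "('a, 'n::finite) chart set \<Rightarrow> 'a metric \<Rightarrow> 'a connection \<Rightarrow> bool" where
  "levi_civita A g D \<longleftrightarrow> linear_connection A D \<and>
     (\<forall>X\<in>vector_fields A. \<forall>Y\<in>vector_fields A. D X Y - D Y X = lie_bracket X Y) \<and>
     (\<forall>X\<in>vector_fields A. \<forall>Y\<in>vector_fields A. \<forall>Z\<in>vector_fields A.
        deriv_along X (metric_app g Y Z) = metric_app g (D X Y) Z + metric_app g Y (D X Z))"

definition parallel_field :: "('a, 'n::finite) chart set \<Rightarrow> 'a connection \<Rightarrow> 'a vfield \<Rightarrow> bool" where
  "parallel_field A D V \<longleftrightarrow> (\<forall>X\<in>vector_fields A. D X V = 0)"

definition unit_field :: "('a, 'n::finite) chart set \<Rightarrow> 'a metric \<Rightarrow> 'a vfield \<Rightarrow> bool" where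
  "unit_field A g V \<longleftrightarrow> V \<in> vector_fields A \<and> (\<forall>p. metric_app g V V p = 1)"


section \<open>Curvature\<close>

definition curvature :: "'a connection \<Rightarrow> 'a vfield \<Rightarrow> 'a vfield \<Rightarrow> 'a vfield \<Rightarrow> 'a vfield" where
  "curvature D X Y Z = D X (D Y Z) - D Y (D X Z) - D (lie_bracket X Y) Z"

text \<open>Trace of an endomorphism of a finite-dimensional space \<open>T\<close>, computed in some basis.\<close>

definition trace_on :: "'v::real_vector set \<Rightarrow> ('v \<Rightarrow> 'v) \<Rightarrow> real" where
  "trace_on T L = (let B = (SOME B. B \<subseteq> T \<and> independent B \<and> T \<subseteq> span B)
     in \<Sum>b\<in>B. representation B (L b) b)"

text \<open>A tensorial map \<open>F\<close> on vector fields induces a linear map on each tangent space: the value of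
  \<open>F X\<close> at \<open>p\<close> depends on \<open>X\<close> only through \<open>X p\<close>.\<close>

definition at_point ::
  "('a, 'n::finite) chart set \<Rightarrow> 'a \<Rightarrow> ('a vfield \<Rightarrow> 'a vfield) \<Rightarrow> 'a tvec \<Rightarrow> 'a tvec" where
  "at_point A p F v = F (SOME X. X \<in> vector_fields A \<and> X p = v) p"

definition ricci ::
  "('a, 'n::finite) chart set \<Rightarrow> 'a connection \<Rightarrow> 'a vfield \<Rightarrow> 'a vfield \<Rightarrow> 'a \<Rightarrow> real" where
  "ricci A D Y Z = (\<lambda>p. trace_on (tangent_space A p) (at_point A p (\<lambda>X. curvature D X Y Z)))"

definition weyl_projective ::
  "('a, 'n::finite) chart set \<Rightarrow> 'a connection \<Rightarrow> 'a vfield \<Rightarrow> 'a vfield \<Rightarrow> 'a vfield \<Rightarrow> 'a vfield"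
  where
  "weyl_projective A D X Y Z = curvature D X Y Z -
     (1 / (real (mdim A) - 1)) *\<^sub>R (ricci A D Y Z \<odot> X - ricci A D X Z \<odot> Y)"

text \<open>The condition \<open>R.P = 0\<close> for the curvature and Weyl projective curvature tensors of \<open>D\<close>.\<close>

definition curvature_annihilates_weyl ::
  "('a, 'n::finite) chart set \<Rightarrow> 'a connection \<Rightarrow> bool" where
  "curvature_annihilates_weyl A D \<longleftrightarrow>
     (\<forall>X\<in>vector_fields A. \<forall>Y\<in>vector_fields A. \<forall>Z\<in>vector_fields A.
      \<forall>U\<in>vector_fields A. \<forall>V\<in>vector_fields A.
        curvature D X Y (weyl_projective A D Z U V)
        - weyl_projective A D (curvature D X Y Z) U V
        - weyl_projective A D Z (curvature D X Y U) V
        - weyl_projective A D Z U (curvature D X Y V) = 0)"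


section \<open>The projective semi-symmetric connection\<close>

definition proj_semisym_connection ::
  "('a, 'n::finite) chart set \<Rightarrow> 'a metric \<Rightarrow> 'a connection \<Rightarrow> 'a vfield \<Rightarrow> 'a connection" where
  "proj_semisym_connection A g D \<xi> X Y =
     (let n = real (mdim A);
          \<pi> = (\<lambda>W. metric_app g W \<xi>);
          \<phi> = (\<lambda>W. (1 / 2) *\<^sub>R \<pi> W);
          \<psi> = (\<lambda>W. ((n - 1) / (2 * (n + 1))) *\<^sub>R \<pi> W)
      in D X Y + \<psi> Y \<odot> X + \<psi> X \<odot> Y + \<phi> Y \<odot> X - \<phi> X \<odot> Y)"

end

theory Submission
  imports Defs
begin

text \<open>Since \<open>\<xi>\<close> is parallel, so is \<open>\<pi>\<close>, and the new connection has curvature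
  \<open>R(X,Y)Z + k \<pi>(Z) (\<pi>(Y) X - \<pi>(X) Y)\<close> with \<open>k = (n / (n + 1))\<^sup>2\<close>. Moreover \<open>R(X,Y)\<xi> = 0\<close>, and by pair
  symmetry \<open>R(X,\<xi>)Z = 0\<close>. Taking the trace, the Weyl tensor satisfies \<open>P(X,Y)\<xi> = 0\<close>. Hence in
  the condition \<open>R.P = 0\<close>, evaluated with last argument \<open>\<xi>\<close> and with the curvature operator of the
  pair \<open>(V/k, \<xi>)\<close>, \<open>V\<close> orthogonal to \<open>\<xi>\<close>, which maps \<open>\<xi>\<close> to \<open>V\<close>, only \<open>P(\<xi>,Y)V = 0\<close> is left. But
  \<open>P(\<xi>,Y)V = - S(Y,V)/(n-1) \<xi>\<close>, so \<open>S(Y,V) = 0\<close>, while \<open>S(Y,\<xi>) = 0\<close> trivially.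

  This choice of arguments applies the curvature operators only to fields known to be smooth
  without any smoothness of the Ricci tensor. That the trace at a point is computed by
  fields at all needs every tangent vector to extend to a global field, which is done with bump
  functions.\<close>

section \<open>Calculus of the classes \<open>C\<close>-\<open>k\<close>\<close>

text \<open>\<open>frechet_derivative\<close> is a choice among all derivatives at the point.
  Functions that agree near \<open>x\<close> have the same derivatives there, so the choices
  coincide, even where no derivative exists.\<close>

lemma frechet_derivative_cong_open:
  assumes "open S" "x \<in> S" "\<And>y. y \<in> S \<Longrightarrow> f y = g y"
  shows "frechet_derivative f (at x) = frechet_derivative g (at x)"
proof -
  have "(f has_derivative D) (at x) \<longleftrightarrow> (g has_derivative D) (at x)" for D
    using has_derivative_transform_within_open[of f D x UNIV S g]
      has_derivative_transform_within_open[of g D x UNIV S f] assms by auto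
  then show ?thesis
    by (simp add: frechet_derivative_def)
qed

lemma Ck_on_cong:
  assumes "open S" "\<And>x. x \<in> S \<Longrightarrow> f x = g x" "Ck_on k S f"
  shows "Ck_on k S g"
  using assms(2,3)
proof (induction k arbitrary: f g)
  case 0
  then show ?case by (simp cong: continuous_on_cong)
next
  case (Suc k)
  have "g differentiable (at x)" if "x \<in> S" for x
  proof -
    have "f differentiable (at x)" using Suc.prems that by simp
    then show ?thesis
      unfolding differentiable_def
      using has_derivative_transform_within_open[of f _ x UNIV S g] assms(1) Suc.prems(1) that
      by blast
  qed
  moreover have "Ck_on k S (\<lambda>x. frechet_derivative g (at x) v)" for v
  proof (rule Suc.IH)
    show "Ck_on k S (\<lambda>x. frechet_derivative f (at x) v)"
      using Suc.prems(2) by simp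
    show "frechet_derivative f (at x) v = frechet_derivative g (at x) v" if "x \<in> S" for x
      using frechet_derivative_cong_open[OF assms(1) that Suc.prems(1)] by simp
  qed
  ultimately show ?case by simp
qed

lemma Ck_on_subset: "Ck_on k S f \<Longrightarrow> T \<subseteq> S \<Longrightarrow> Ck_on k T f"
  by (induction k arbitrary: f) (auto intro: continuous_on_subset)

lemma Ck_on_Un:
  "open S \<Longrightarrow> open T \<Longrightarrow> Ck_on k S f \<Longrightarrow> Ck_on k T f \<Longrightarrow> Ck_on k (S \<union> T) f"
  by (induction k arbitrary: f) (auto intro: continuous_on_open_Un)

lemma Ck_on_Suc_imp: "Ck_on (Suc k) S f \<Longrightarrow> Ck_on k S f"
proof (induction k arbitrary: f)
  case 0
  then show ?case
    by (auto intro!: continuous_at_imp_continuous_on differentiable_imp_continuous_within)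
next
  case (Suc k)
  have "Ck_on k S (\<lambda>x. frechet_derivative f (at x) v)" for v
    using Suc.prems by (intro Suc.IH) simp
  then show ?case using Suc.prems by simp
qed

lemma Ck_on_const: "Ck_on k S (\<lambda>x. c)"
  by (induction k arbitrary: c) auto

lemma Ck_on_bounded_linear: "bounded_linear f \<Longrightarrow> Ck_on k S f"
proof (cases k)
  case 0
  assume "bounded_linear f"
  then show ?thesis using 0 by (simp add: linear_continuous_on)
next
  case (Suc m)
  assume f: "bounded_linear f"
  have "frechet_derivative f (at x) = f" for x
    using bounded_linear_imp_has_derivative[OF f] by (metis frechet_derivative_at)
  then show ?thesis
    using Suc f bounded_linear_imp_differentiable by (auto intro: Ck_on_const)
qed

lemma Ck_on_add:
  assumes "open S" "Ck_on k S f" "Ck_on k S g"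
  shows "Ck_on k S (\<lambda>x. f x + g x)"
  using assms(2,3)
proof (induction k arbitrary: f g)
  case 0
  then show ?case by (auto intro: continuous_on_add)
next
  case (Suc k)
  have der: "((\<lambda>x. f x + g x) has_derivative
      (\<lambda>v. frechet_derivative f (at x) v + frechet_derivative g (at x) v)) (at x)" if "x \<in> S" for x
    using Suc.prems that by (intro has_derivative_add) (auto simp: frechet_derivative_works)
  have "Ck_on k S (\<lambda>x. frechet_derivative f (at x) v + frechet_derivative g (at x) v)" for v
    using Suc.prems by (intro Suc.IH) auto
  then have "Ck_on k S (\<lambda>x. frechet_derivative (\<lambda>x. f x + g x) (at x) v)" for v
    by (rule Ck_on_cong[OF assms(1), rotated]) (simp add: frechet_derivative_at[OF der, symmetric])
  then show ?case
    using der by (auto simp: differentiable_def)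
qed

lemma Ck_on_sum:
  assumes "open S" "\<And>i. i \<in> I \<Longrightarrow> Ck_on k S (f i)"
  shows "Ck_on k S (\<lambda>x. \<Sum>i\<in>I. f i x)"
  using assms(2)
  by (induction I rule: infinite_finite_induct) (simp_all add: Ck_on_const Ck_on_add assms(1))

text \<open>Induction along the Leibniz rule: each term of the derivative keeps one factor
  undifferentiated, and that factor is lowered from class \<open>Suc k\<close> to \<open>k\<close>.
  Products, scalings and inner products are instances.\<close>

lemma Ck_on_bilinear:
  assumes "bounded_bilinear h" "open S" "Ck_on k S f" "Ck_on k S g"
  shows "Ck_on k S (\<lambda>x. h (f x) (g x))"
  using assms(3,4)
proof (induction k arbitrary: f g)
  case 0
  then show ?case using bounded_bilinear.continuous_on[OF assms(1)] by auto
next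
  case (Suc k)
  have der: "((\<lambda>x. h (f x) (g x)) has_derivative
      (\<lambda>v. h (f x) (frechet_derivative g (at x) v) + h (frechet_derivative f (at x) v) (g x))) (at x)"
    if "x \<in> S" for x
    using Suc.prems that
    by (intro bounded_bilinear.FDERIV[OF assms(1)]) (auto simp: frechet_derivative_works)
  have "Ck_on k S (\<lambda>x. h (f x) (frechet_derivative g (at x) v) + h (frechet_derivative f (at x) v) (g x))" for v
    using Suc.prems by (intro Ck_on_add assms(2) Suc.IH Ck_on_Suc_imp[of k S f] Ck_on_Suc_imp[of k S g]) auto
  then have "Ck_on k S (\<lambda>x. frechet_derivative (\<lambda>x. h (f x) (g x)) (at x) v)" for v
    by (rule Ck_on_cong[OF assms(2), rotated]) (simp add: frechet_derivative_at[OF der, symmetric])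
  then show ?case
    using der by (auto simp: differentiable_def)
qed

lemmas Ck_on_mult = Ck_on_bilinear[OF bounded_bilinear_mult]
lemmas Ck_on_scaleR = Ck_on_bilinear[OF bounded_bilinear_scaleR]
lemmas Ck_on_inner = Ck_on_bilinear[OF bounded_bilinear_inner]

text \<open>In the chain rule the direction in which \<open>f\<close> is differentiated varies with
  \<open>x\<close>, whereas \<open>Ck_on\<close> speaks of fixed directions. Expanding in
  \<open>Basis\<close> moves the variation into scalar coefficients.\<close>

lemma frechet_derivative_compose_Basis:
  fixes f :: "'v::euclidean_space \<Rightarrow> 'w::real_normed_vector"
  assumes "f differentiable (at (g x))" "g differentiable (at x)"
  shows "frechet_derivative (f \<circ> g) (at x) v =
    (\<Sum>b\<in>Basis. (frechet_derivative g (at x) v \<bullet> b) *\<^sub>R frechet_derivative f (at (g x)) b)"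
proof -
  have lin: "linear (frechet_derivative f (at (g x)))"
    using assms(1) by (simp add: linear_frechet_derivative)
  have "frechet_derivative (f \<circ> g) (at x) v =
      frechet_derivative f (at (g x)) (frechet_derivative g (at x) v)"
    using assms by (simp add: frechet_derivative_compose)
  also have "\<dots> = frechet_derivative f (at (g x)) (\<Sum>b\<in>Basis. (frechet_derivative g (at x) v \<bullet> b) *\<^sub>R b)"
    by (simp only: euclidean_representation)
  also have "\<dots> = (\<Sum>b\<in>Basis. (frechet_derivative g (at x) v \<bullet> b) *\<^sub>R frechet_derivative f (at (g x)) b)"
    by (simp add: linear_sum[OF lin] linear_cmul[OF lin])
  finally show ?thesis .
qed

text \<open>Only \<open>f\<close> varies in the induction: the partial derivatives of
  \<open>f\<close> composed with the same \<open>g\<close> are of class \<open>k\<close>, and their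
  coefficients in the coordinate chain rule are components of derivatives of
  \<open>g\<close>.\<close>

lemma Ck_on_compose:
  fixes f :: "'v::euclidean_space \<Rightarrow> 'w::real_normed_vector"
  assumes "open S" "g ` S \<subseteq> T" "Ck_on k T f" "Ck_on k S g"
  shows "Ck_on k S (f \<circ> g)"
  using assms(3,4)
proof (induction k arbitrary: f)
  case 0
  then show ?case
    using assms(2) continuous_on_compose[of S g f] continuous_on_subset[of T f] by simp
next
  case (Suc k)
  have diff: "f differentiable (at (g x))" "g differentiable (at x)" if "x \<in> S" for x
    using Suc.prems assms(2) that by auto
  have "Ck_on k S ((\<lambda>y. frechet_derivative f (at y) b) \<circ> g)" for b
    using Suc.prems by (intro Suc.IH Ck_on_Suc_imp[of k S g]) auto
  then have "Ck_on k S (\<lambda>x. \<Sum>b\<in>Basis. (frechet_derivative g (at x) v \<bullet> b) *\<^sub>R frechet_derivative f (at (g x)) b)" for v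
    using Suc.prems
    by (intro Ck_on_sum Ck_on_scaleR Ck_on_inner Ck_on_const assms(1)) (auto simp: o_def)
  then have "Ck_on k S (\<lambda>x. frechet_derivative (f \<circ> g) (at x) v)" for v
    by (rule Ck_on_cong[OF assms(1), rotated]) (simp add: frechet_derivative_compose_Basis diff)
  then show ?case
    using diff by (simp del: o_apply add: differentiable_chain_at)
qed

lemma Cinf_on_differentiable: "Cinf_on S f \<Longrightarrow> x \<in> S \<Longrightarrow> f differentiable (at x)"
  unfolding Cinf_on_def by (drule spec[of _ "Suc 0"]) simp

lemma Cinf_on_frechet_derivative: "Cinf_on S f \<Longrightarrow> Cinf_on S (\<lambda>x. frechet_derivative f (at x) v)"
  unfolding Cinf_on_def by (rule allI, drule_tac x = "Suc k" in spec) simp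

lemma Cinf_on_const: "Cinf_on S (\<lambda>x. c)"
  by (simp add: Cinf_on_def Ck_on_const)

lemma Cinf_on_add: "open S \<Longrightarrow> Cinf_on S f \<Longrightarrow> Cinf_on S g \<Longrightarrow> Cinf_on S (\<lambda>x. f x + g x)"
  by (simp add: Cinf_on_def Ck_on_add)

lemma Cinf_on_mult:
  fixes f g :: "_ \<Rightarrow> real"
  shows "open S \<Longrightarrow> Cinf_on S f \<Longrightarrow> Cinf_on S g \<Longrightarrow> Cinf_on S (\<lambda>x. f x * g x)"
  by (simp add: Cinf_on_def Ck_on_mult)

lemma Cinf_on_subset: "Cinf_on S f \<Longrightarrow> T \<subseteq> S \<Longrightarrow> Cinf_on T f"
  unfolding Cinf_on_def using Ck_on_subset by blast

lemma Cinf_on_cong: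
  "open S \<Longrightarrow> (\<And>x. x \<in> S \<Longrightarrow> f x = g x) \<Longrightarrow> Cinf_on S f \<Longrightarrow> Cinf_on S g"
  unfolding Cinf_on_def by (blast intro: Ck_on_cong)

lemma Cinf_on_Un: "open S \<Longrightarrow> open T \<Longrightarrow> Cinf_on S f \<Longrightarrow> Cinf_on T f \<Longrightarrow> Cinf_on (S \<union> T) f"
  by (simp add: Cinf_on_def Ck_on_Un)

lemma Cinf_on_compose:
  fixes f :: "'v::euclidean_space \<Rightarrow> 'w::real_normed_vector"
  shows "open S \<Longrightarrow> g ` S \<subseteq> T \<Longrightarrow> Cinf_on T f \<Longrightarrow> Cinf_on S g \<Longrightarrow> Cinf_on S (f \<circ> g)"
  unfolding Cinf_on_def using Ck_on_compose by blast

section \<open>Bump functions\<close>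

text \<open>The case \<open>m = 0\<close> is the classical function that is flat at 0. The powers of
  \<open>1 / t\<close> make the linear span of the family closed under differentiation.\<close>

definition flat_exp :: "nat \<Rightarrow> real \<Rightarrow> real" where
  "flat_exp m t = (if t > 0 then (1 / t) ^ m * exp (- (1 / t)) else 0)"

lemma flat_exp_tendsto_0: "(flat_exp m \<longlongrightarrow> 0) (at 0)"
proof -
  \<comment> \<open>Substituting s = 1/t turns this into the limit of a power of s divided by exp(s)
    at infinity.\<close>
  have "((\<lambda>t::real. (1 / t) ^ m / exp (1 / t)) \<longlongrightarrow> 0) (at_right 0)"
    using filterlim_compose[OF tendsto_power_div_exp_0 filterlim_inverse_at_top_right]
    by (simp add: inverse_eq_divide)
  then have "(flat_exp m \<longlongrightarrow> 0) (at_right 0)"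
    by (rule tendsto_cong[THEN iffD1, rotated])
      (auto simp: flat_exp_def exp_minus divide_inverse eventually_at_right_less
        intro!: eventually_mono[OF eventually_at_right_less[of "0::real"]])
  moreover have "(flat_exp m \<longlongrightarrow> 0) (at_left 0)"
    by (rule tendsto_cong[THEN iffD1, OF _ tendsto_const])
      (auto simp: flat_exp_def eventually_at_left_field intro!: exI[of _ "-1"])
  ultimately show ?thesis
    by (simp add: filterlim_split_at)
qed

lemma flat_exp_has_derivative:
  "(flat_exp m has_real_derivative (flat_exp (m + 2) t - real m * flat_exp (m + 1) t)) (at t)"
proof -
  consider "t < 0" | "t = 0" | "t > 0" by linarith
  then show ?thesis
  proof cases
    case 1
    have "((\<lambda>_. 0) has_real_derivative 0) (at t)" by simp
    then have "(flat_exp m has_real_derivative 0) (at t)"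
      by (rule has_field_derivative_transform_within_open[where S = "{..<0}"])
        (use 1 in \<open>auto simp: flat_exp_def\<close>)
    then show ?thesis using 1 by (simp add: flat_exp_def)
  next
    case 2
    \<comment> \<open>The difference quotient at 0 is the next member of the family, which tends to
      0.\<close>
    have "flat_exp m h / h = flat_exp (Suc m) h" for h
      by (simp add: flat_exp_def)
    then have "(flat_exp m has_real_derivative 0) (at 0)"
      using flat_exp_tendsto_0[of "Suc m"] by (simp add: DERIV_def flat_exp_def[of m 0])
    then show ?thesis using 2 by (simp add: flat_exp_def)
  next
    case 3
    have "((\<lambda>t. (1 / t) ^ m * exp (- (1 / t))) has_real_derivative
        flat_exp (m + 2) t - real m * flat_exp (m + 1) t) (at t)"
    proof -
      have inv: "((\<lambda>t. 1 / t) has_real_derivative - (1 / t)\<^sup>2) (at t)"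
        using DERIV_inverse[of t] 3 by (simp add: inverse_eq_divide power2_eq_square)
      \<comment> \<open>For \<open>m = 0\<close> the exponent \<open>m - 1\<close> is truncated, but
        the factor \<open>real m\<close> removes that term.\<close>
      have "((\<lambda>t. (1 / t) ^ m * exp (- (1 / t))) has_real_derivative
          (real m * (1 / t) ^ (m - 1) * (- (1 / t)\<^sup>2)) * exp (- (1 / t)) +
          (exp (- (1 / t)) * (1 / t)\<^sup>2) * (1 / t) ^ m) (at t)"
        using DERIV_mult[OF DERIV_power[OF inv] DERIV_fun_exp[OF DERIV_minus[OF inv]]]
        by (simp add: mult.assoc mult.left_commute)
      moreover have "real m * (1 / t) ^ (m - 1) * (- (1 / t)\<^sup>2) * exp (- (1 / t)) +
          exp (- (1 / t)) * (1 / t)\<^sup>2 * (1 / t) ^ m = flat_exp (m + 2) t - real m * flat_exp (m + 1) t"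
        using 3 by (cases m) (simp_all add: flat_exp_def power2_eq_square algebra_simps add_divide_distrib)
      ultimately show ?thesis by simp
    qed
    then show ?thesis
      by (rule has_field_derivative_transform_within_open[where S = "{0<..}"])
        (use 3 in \<open>auto simp: flat_exp_def\<close>)
  qed
qed

lemma Ck_on_flat_exp: "Ck_on k UNIV (flat_exp m)"
proof (induction k arbitrary: m)
  case 0
  then show ?case
    using DERIV_isCont[OF flat_exp_has_derivative] by (simp add: continuous_at_imp_continuous_on)
next
  case (Suc k)
  have der: "(flat_exp m has_derivative (*) (flat_exp (m + 2) t + (- real m) * flat_exp (m + 1) t)) (at t)" for t
    using flat_exp_has_derivative[of m t] by (simp add: has_field_derivative_def)
  have "Ck_on k UNIV (\<lambda>t. (flat_exp (m + 2) t + (- real m) * flat_exp (m + 1) t) * v)" for v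
    by (intro Ck_on_mult Ck_on_add Ck_on_const Suc.IH open_UNIV)
  then show ?case
    unfolding Ck_on.simps frechet_derivative_at[OF der, symmetric]
    using der by (meson differentiableI)
qed

lemma bump_function_exists:
  fixes z0 :: "'v::euclidean_space"
  assumes "r > 0"
  obtains \<beta> :: "'v \<Rightarrow> real"
  where "Cinf_on UNIV \<beta>" "\<beta> z0 \<noteq> 0" "\<And>z. z \<notin> cball z0 r \<Longrightarrow> \<beta> z = 0"
proof
  \<comment> \<open>This is \<open>r\<^sup>2\<close> minus the squared distance to
    \<open>z0\<close>: positive at \<open>z0\<close> and negative off the closed ball, where
    \<open>flat_exp 0\<close> vanishes. Writing it with sums, products and inner products alone lets
    the closure rules apply.\<close>
  let ?q = "\<lambda>z. r\<^sup>2 + (-1) * ((z + (- z0)) \<bullet> (z + (- z0)))"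
  have "Ck_on k UNIV ?q" for k
    by (intro Ck_on_add Ck_on_mult Ck_on_inner Ck_on_const Ck_on_bounded_linear bounded_linear_ident open_UNIV)
  then have "Ck_on k UNIV (flat_exp 0 \<circ> ?q)" for k
    by (intro Ck_on_compose[where T = UNIV] Ck_on_flat_exp) auto
  then show "Cinf_on UNIV (flat_exp 0 \<circ> ?q)"
    by (simp add: Cinf_on_def)
  show "(flat_exp 0 \<circ> ?q) z0 \<noteq> 0"
    using assms by (simp add: flat_exp_def)
  show "(flat_exp 0 \<circ> ?q) z = 0" if "z \<notin> cball z0 r" for z
  proof -
    have "r\<^sup>2 \<le> (norm (z - z0))\<^sup>2"
      using that assms by (intro power_mono) (auto simp: dist_norm norm_minus_commute)
    then show ?thesis
      by (simp add: flat_exp_def dot_square_norm)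
  qed
qed


section \<open>Tangent spaces and vector fields\<close>

lemma chart_open_image:
  assumes "is_chart (U, x)" "open W" "W \<subseteq> U"
  shows "open (x ` W)"
proof -
  have "openin (top_of_set (x ` U)) (x ` W)"
    using homeomorphism_imp_open_map[of U "x ` U" x "inv_into U x" W] assms
    by (auto simp: is_chart_def openin_open_eq)
  then show ?thesis
    using assms(1) by (auto simp: is_chart_def openin_open_eq)
qed

lemma chart_inv_into: "is_chart (U, x) \<Longrightarrow> q \<in> U \<Longrightarrow> inv_into U x (x q) = q"
  by (auto simp: is_chart_def homeomorphism_def)

lemma smooth_funs_chart: "f \<in> smooth_funs A \<Longrightarrow> (U, x) \<in> A \<Longrightarrow> Cinf_on (x ` U) (f \<circ> inv_into U x)"
  by (auto simp: smooth_funs_def)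

lemma atlas_chart: "smooth_atlas A \<Longrightarrow> c \<in> A \<Longrightarrow> is_chart c"
  by (auto simp: smooth_atlas_def)

lemma atlas_covers:
  assumes "smooth_atlas A"
  obtains U x where "(U, x) \<in> A" "p \<in> U"
proof -
  have "p \<in> (\<Union>c\<in>A. fst c)"
    using assms by (simp add: smooth_atlas_def)
  then show ?thesis
    using that by auto
qed

lemma chart_open: "is_chart (U, x) \<Longrightarrow> open U" "is_chart (U, x) \<Longrightarrow> open (x ` U)"
  by (auto simp: is_chart_def)

lemma smooth_funs_differentiable:
  assumes "smooth_atlas A" "(U, x) \<in> A" "p \<in> U" "f \<in> smooth_funs A"
  shows "(f \<circ> inv_into U x) differentiable (at (x p))"
  using smooth_funs_chart[OF assms(4,2)] Cinf_on_differentiable assms(3) by blast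

lemma smooth_funs_add:
  assumes "smooth_atlas A" "f \<in> smooth_funs A" "h \<in> smooth_funs A"
  shows "(\<lambda>p. f p + h p) \<in> smooth_funs A"
  using Cinf_on_add[OF chart_open(2)[OF atlas_chart[OF assms(1)]]] assms
  by (fastforce simp: smooth_funs_def o_def)

lemma smooth_funs_mult:
  assumes "smooth_atlas A" "f \<in> smooth_funs A" "h \<in> smooth_funs A"
  shows "(\<lambda>p. f p * h p) \<in> smooth_funs A"
  using Cinf_on_mult[OF chart_open(2)[OF atlas_chart[OF assms(1)]]] assms
  by (fastforce simp: smooth_funs_def o_def)

lemma smooth_funs_const: "(\<lambda>p. c) \<in> smooth_funs A"
  by (auto simp: smooth_funs_def o_def Cinf_on_const)

lemma smooth_funs_cmult:
  "smooth_atlas A \<Longrightarrow> f \<in> smooth_funs A \<Longrightarrow> (\<lambda>p. c * f p) \<in> smooth_funs A"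
  using smooth_funs_mult smooth_funs_const by blast

section \<open>Change of charts and the linear structure of tangent spaces\<close>

lemma chart_tvec_change:
  assumes "smooth_atlas A" "(U, x) \<in> A" "(V, y) \<in> A" "p \<in> U" "p \<in> V"
  shows "chart_tvec A (U, x) p w =
    chart_tvec A (V, y) p (frechet_derivative (y \<circ> inv_into U x) (at (x p)) w)"
proof
  fix f
  note chU = atlas_chart[OF assms(1,2)] and chV = atlas_chart[OF assms(1,3)]
  have op: "open (x ` (U \<inter> V))"
    using chart_open[OF chU] chart_open[OF chV] by (intro chart_open_image[OF chU]) auto
  show "chart_tvec A (U, x) p w f =
    chart_tvec A (V, y) p (frechet_derivative (y \<circ> inv_into U x) (at (x p)) w) f"
  proof (cases "f \<in> smooth_funs A")
    case True
    have "Cinf_on (x ` (U \<inter> V)) (y \<circ> inv_into U x)"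
      using assms by (fastforce simp: smooth_atlas_def)
    then have dy: "(y \<circ> inv_into U x) differentiable (at (x p))"
      using assms by (auto intro: Cinf_on_differentiable)
    have yp: "(y \<circ> inv_into U x) (x p) = y p"
      using chart_inv_into[OF chU] assms(4) by simp
    have df: "(f \<circ> inv_into V y) differentiable (at (y p))"
      by (rule smooth_funs_differentiable[OF assms(1,3,5) True])
    \<comment> \<open>Near \<open>x p\<close> the expression of \<open>f\<close> in the first chart
      factors through the transition map, so the chain rule transports components by its
      derivative.\<close>
    have "frechet_derivative (f \<circ> inv_into U x) (at (x p)) =
        frechet_derivative ((f \<circ> inv_into V y) \<circ> (y \<circ> inv_into U x)) (at (x p))"
      by (rule frechet_derivative_cong_open[OF op])
        (use assms chart_inv_into[OF chU] chart_inv_into[OF chV] in auto)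
    also have "\<dots> = frechet_derivative (f \<circ> inv_into V y) (at (y p)) \<circ>
        frechet_derivative (y \<circ> inv_into U x) (at (x p))"
      using frechet_derivative_compose[of "y \<circ> inv_into U x" "x p" "f \<circ> inv_into V y"] dy df yp
      by simp
    finally show ?thesis
      using True by (simp add: chart_tvec_def)
  qed (simp add: chart_tvec_def)
qed

lemma tangent_space_chart:
  assumes "smooth_atlas A" "(U, x) \<in> A" "p \<in> U"
  shows "tangent_space A p = range (chart_tvec A (U, x) p)"
proof
  show "tangent_space A p \<subseteq> range (chart_tvec A (U, x) p)"
    using chart_tvec_change[OF assms(1) _ assms(2) _ assms(3)] by (auto simp: tangent_space_def)
  show "range (chart_tvec A (U, x) p) \<subseteq> tangent_space A p"
    using assms(2,3) by (force simp: tangent_space_def)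
qed

lemma linear_chart_tvec:
  assumes "smooth_atlas A" "(U, x) \<in> A" "p \<in> U"
  shows "linear (chart_tvec A (U, x) p)"
proof
  have lin: "linear (frechet_derivative (f \<circ> inv_into U x) (at (x p)))" if "f \<in> smooth_funs A" for f
    using smooth_funs_differentiable[OF assms that] by (rule linear_frechet_derivative)
  show "chart_tvec A (U, x) p (v + w) = chart_tvec A (U, x) p v + chart_tvec A (U, x) p w" for v w
    using linear_add[OF lin] by (auto simp: chart_tvec_def fun_eq_iff)
  show "chart_tvec A (U, x) p (r *\<^sub>R v) = r *\<^sub>R chart_tvec A (U, x) p v" for r v
    using linear_cmul[OF lin] by (auto simp: chart_tvec_def fun_eq_iff scaleR_fun_def)
qed

lemma subspace_tangent_space:
  assumes "smooth_atlas A"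
  shows "subspace (tangent_space A p)"
proof -
  obtain U x where "(U, x) \<in> A" "p \<in> U"
    using atlas_covers[OF assms] .
  then show ?thesis
    using tangent_space_chart[OF assms] linear_subspace_image[OF linear_chart_tvec[OF assms] subspace_UNIV]
    by simp
qed

lemma tangent_vector_linear:
  assumes "smooth_atlas A" "v \<in> tangent_space A p" "f \<in> smooth_funs A" "h \<in> smooth_funs A"
  shows "v (\<lambda>q. a * f q + b * h q) = a * v f + b * v h"
proof -
  obtain U x where c: "(U, x) \<in> A" "p \<in> U"
    using atlas_covers[OF assms(1)] .
  then obtain w where v: "v = chart_tvec A (U, x) p w"
    using tangent_space_chart[OF assms(1)] assms(2) by auto
  note df = smooth_funs_differentiable[OF assms(1) c assms(3)]
    and dh = smooth_funs_differentiable[OF assms(1) c assms(4)]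
  have "((\<lambda>z. a * (f \<circ> inv_into U x) z + b * (h \<circ> inv_into U x) z) has_derivative
      (\<lambda>w. a * frechet_derivative (f \<circ> inv_into U x) (at (x p)) w +
        b * frechet_derivative (h \<circ> inv_into U x) (at (x p)) w)) (at (x p))"
    using df dh unfolding frechet_derivative_works
    by (intro has_derivative_add has_derivative_mult_right)
  then have "frechet_derivative ((\<lambda>q. a * f q + b * h q) \<circ> inv_into U x) (at (x p)) =
      (\<lambda>w. a * frechet_derivative (f \<circ> inv_into U x) (at (x p)) w +
        b * frechet_derivative (h \<circ> inv_into U x) (at (x p)) w)"
    by (intro frechet_derivative_at[symmetric]) (simp add: o_def)
  then show ?thesis
    using assms smooth_funs_add[OF assms(1) smooth_funs_cmult smooth_funs_cmult]
    by (simp add: v chart_tvec_def)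
qed

lemma tangent_vector_nonsmooth: "v \<in> tangent_space A p \<Longrightarrow> f \<notin> smooth_funs A \<Longrightarrow> v f = 0"
  by (auto simp: tangent_space_def chart_tvec_def)

lemma vector_fields_tangent: "X \<in> vector_fields A \<Longrightarrow> X p \<in> tangent_space A p"
  by (auto simp: vector_fields_def)

lemma vector_fields_smooth: "X \<in> vector_fields A \<Longrightarrow> f \<in> smooth_funs A \<Longrightarrow> deriv_along X f \<in> smooth_funs A"
  by (auto simp: vector_fields_def)

lemma vector_fields_add:
  assumes "smooth_atlas A" "X \<in> vector_fields A" "Y \<in> vector_fields A"
  shows "X + Y \<in> vector_fields A"
proof -
  have "deriv_along (X + Y) h = (\<lambda>p. deriv_along X h p + deriv_along Y h p)" for h
    by (simp add: deriv_along_def)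
  then show ?thesis
    using assms by (simp add: vector_fields_def smooth_funs_add subspace_add subspace_tangent_space)
qed

lemma vector_fields_fmult:
  assumes "smooth_atlas A" "f \<in> smooth_funs A" "X \<in> vector_fields A"
  shows "f \<odot> X \<in> vector_fields A"
proof -
  have "deriv_along (f \<odot> X) h = (\<lambda>p. f p * deriv_along X h p)" for h
    by (simp add: deriv_along_def fmult_def scaleR_fun_def)
  moreover have "(f \<odot> X) p \<in> tangent_space A p" for p
    using assms by (simp add: vector_fields_def fmult_def subspace_mul subspace_tangent_space)
  ultimately show ?thesis
    using assms by (simp add: vector_fields_def smooth_funs_mult)
qed

lemma vector_fields_scaleR:
  "smooth_atlas A \<Longrightarrow> X \<in> vector_fields A \<Longrightarrow> c *\<^sub>R X \<in> vector_fields A"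
  using vector_fields_fmult[OF _ smooth_funs_const, of A X c]
  by (simp add: fmult_def scaleR_fun_def)

lemma vector_fields_diff:
  "smooth_atlas A \<Longrightarrow> X \<in> vector_fields A \<Longrightarrow> Y \<in> vector_fields A \<Longrightarrow> X - Y \<in> vector_fields A"
  using vector_fields_add[of A X "(-1) *\<^sub>R Y"] vector_fields_scaleR[of A Y "-1"] by simp

lemma vector_fields_zero:
  assumes "smooth_atlas A"
  shows "0 \<in> vector_fields A"
proof -
  have "deriv_along 0 f = (\<lambda>p. 0)" for f :: "'a \<Rightarrow> real"
    by (simp add: deriv_along_def)
  then show ?thesis
    using subspace_0[OF subspace_tangent_space[OF assms]] smooth_funs_const[of 0 A]
    by (simp add: vector_fields_def)
qed

section \<open>Cut-off functions, extension of tangent vectors, and the dimension\<close>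

lemma cutoff_smooth:
  fixes A :: "('a::{t2_space, second_countable_topology}, 'n::finite) chart set"
  assumes A: "smooth_atlas A" and c: "(U, x) \<in> A" and K: "cball z r \<subseteq> x ` U"
    and \<beta>: "Cinf_on UNIV \<beta>" "\<And>z'. z' \<notin> cball z r \<Longrightarrow> \<beta> z' = 0" and G: "Cinf_on (x ` U) G"
  shows "(\<lambda>q. if q \<in> U then \<beta> (x q) * G (x q) else 0) \<in> smooth_funs A" (is "?F \<in> _")
  unfolding smooth_funs_def
proof (intro CollectI ballI, clarify)
  fix V y assume d: "(V, y) \<in> A"
  note ch = atlas_chart[OF A c] and chV = atlas_chart[OF A d]
  define C where "C = inv_into U x ` cball z r"
  have "continuous_on (x ` U) (inv_into U x)"
    using ch by (auto simp: is_chart_def homeomorphism_def)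
  then have "compact C"
    unfolding C_def by (intro compact_continuous_image compact_cball) (rule continuous_on_subset[OF _ K])
  \<comment> \<open>this is where the manifold has to be Hausdorff\<close>
  then have C: "closed C"
    by (rule compact_imp_closed)
  have CU: "C \<subseteq> U"
    using K by (auto simp: C_def intro!: inv_into_into)
  have \<beta>0: "\<beta> (x q) = 0" if "q \<in> U" "q \<notin> C" for q
    using that chart_inv_into[OF ch] by (intro \<beta>(2)) (force simp: C_def)
  have op: "open (y ` (V \<inter> U))" "open (y ` (V - C))"
    using chart_open[OF ch] chart_open[OF chV] C by (auto intro!: chart_open_image[OF chV])
  have \<beta>G: "Cinf_on (x ` U) (\<lambda>z. \<beta> z * G z)"
    using G Cinf_on_subset[OF \<beta>(1)] by (intro Cinf_on_mult chart_open(2)[OF ch]) auto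
  have "Cinf_on (y ` (V \<inter> U)) (x \<circ> inv_into V y)"
    using A c d by (fastforce simp: smooth_atlas_def)
  then have "Cinf_on (y ` (V \<inter> U)) ((\<lambda>z. \<beta> z * G z) \<circ> (x \<circ> inv_into V y))"
    by (rule Cinf_on_compose[OF op(1) _ \<beta>G, rotated]) (auto simp: chart_inv_into[OF chV])
  then have 1: "Cinf_on (y ` (V \<inter> U)) (?F \<circ> inv_into V y)"
    by (rule Cinf_on_cong[OF op(1), rotated]) (auto simp: chart_inv_into[OF chV])
  have 2: "Cinf_on (y ` (V - C)) (?F \<circ> inv_into V y)"
    by (rule Cinf_on_cong[OF op(2) _ Cinf_on_const[of _ 0]])
      (auto simp: chart_inv_into[OF chV] \<beta>0)
  have "y ` V = y ` (V \<inter> U) \<union> y ` (V - C)"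
    using CU by blast
  then show "Cinf_on (y ` V) (?F \<circ> inv_into V y)"
    using Cinf_on_Un[OF op 1 2] by simp
qed

lemma chart_bump_exists:
  fixes A :: "('a::{t2_space, second_countable_topology}, 'n::finite) chart set"
  assumes "smooth_atlas A" "(U, x) \<in> A" "p \<in> U"
  obtains \<beta> where "Cinf_on UNIV \<beta>" "\<beta> (x p) \<noteq> 0"
    "\<And>G. Cinf_on (x ` U) G \<Longrightarrow> (\<lambda>q. if q \<in> U then \<beta> (x q) * G (x q) else 0) \<in> smooth_funs A"
proof -
  obtain r where r: "r > 0" "cball (x p) r \<subseteq> x ` U"
    using chart_open(2)[OF atlas_chart[OF assms(1,2)]] assms(3) open_contains_cball by (metis imageI)
  obtain \<beta> :: "real ^ 'n \<Rightarrow> real" where \<beta>: "Cinf_on UNIV \<beta>" "\<beta> (x p) \<noteq> 0"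
      "\<And>z. z \<notin> cball (x p) r \<Longrightarrow> \<beta> z = 0"
    using bump_function_exists[OF r(1), of "x p"] by blast
  then show ?thesis
    using that cutoff_smooth[OF assms(1,2) r(2)] by blast
qed

lemma tangent_vector_extends:
  fixes A :: "('a::{t2_space, second_countable_topology}, 'n::finite) chart set"
  assumes A: "smooth_atlas A" and v: "v \<in> tangent_space A p"
  shows "\<exists>X\<in>vector_fields A. X p = v"
proof -
  obtain U x where c: "(U, x) \<in> A" "p \<in> U"
    using atlas_covers[OF A] .
  obtain w where w: "v = chart_tvec A (U, x) p w"
    using tangent_space_chart[OF A c] v by auto
  obtain \<beta> where \<beta>: "\<beta> (x p) \<noteq> 0"
    "\<And>G. Cinf_on (x ` U) G \<Longrightarrow> (\<lambda>q. if q \<in> U then \<beta> (x q) * G (x q) else 0) \<in> smooth_funs A"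
    using chart_bump_exists[OF A c] by blast
  \<comment> \<open>The field with constant components \<open>w\<close> in the chart, cut off to be
    global. The bump is only known to be nonzero at \<open>x p\<close>, so a division by its value
    there follows.\<close>
  define X where "X q = (if q \<in> U then \<beta> (x q) *\<^sub>R chart_tvec A (U, x) q w else 0)" for q
  have "X q \<in> tangent_space A q" for q
  proof (cases "q \<in> U")
    case True
    then have "chart_tvec A (U, x) q w \<in> tangent_space A q"
      using tangent_space_chart[OF A c(1)] by blast
    then show ?thesis
      using True subspace_mul[OF subspace_tangent_space[OF A]] by (simp add: X_def)
  qed (simp add: X_def subspace_0[OF subspace_tangent_space[OF A]])
  moreover have "deriv_along X f \<in> smooth_funs A" if f: "f \<in> smooth_funs A" for f
  proof -
    have "deriv_along X f = (\<lambda>q. if q \<in> U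
        then \<beta> (x q) * frechet_derivative (f \<circ> inv_into U x) (at (x q)) w else 0)"
      using f by (auto simp: deriv_along_def X_def chart_tvec_def scaleR_fun_def)
    then show ?thesis
      using \<beta>(2)[OF Cinf_on_frechet_derivative[OF smooth_funs_chart[OF f c(1)]]] by simp
  qed
  ultimately have "X \<in> vector_fields A"
    by (simp add: vector_fields_def)
  then have "(1 / \<beta> (x p)) *\<^sub>R X \<in> vector_fields A"
    by (rule vector_fields_scaleR[OF A])
  moreover have "((1 / \<beta> (x p)) *\<^sub>R X) p = v"
    using \<beta>(1) c(2) by (simp add: X_def w scaleR_fun_def)
  ultimately show ?thesis by blast
qed

text \<open>Tangent vectors act on globally smooth functions, so separating components requires
  enough such functions; cut-offs supply them. This makes the dimension of the tangent space that of
  the chart.\<close>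

lemma inj_chart_tvec:
  fixes A :: "('a::{t2_space, second_countable_topology}, 'n::finite) chart set"
  assumes A: "smooth_atlas A" and c: "(U, x) \<in> A" "p \<in> U"
  shows "inj (chart_tvec A (U, x) p)"
proof -
  obtain \<beta> where \<beta>: "Cinf_on UNIV \<beta>" "\<beta> (x p) \<noteq> 0"
    "\<And>G. Cinf_on (x ` U) G \<Longrightarrow> (\<lambda>q. if q \<in> U then \<beta> (x q) * G (x q) else 0) \<in> smooth_funs A"
    using chart_bump_exists[OF A c] by blast
  note ch = atlas_chart[OF A c(1)]
  have "w = 0" if w: "chart_tvec A (U, x) p w = 0" for w
  proof -
    \<comment> \<open>The cut-off of an affine function vanishing at \<open>x p\<close> has a nonzero multiple of its linear part
      as derivative there.\<close>
    define G where "G z = (z - x p) \<bullet> w" for z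
    define f where "f q = (if q \<in> U then \<beta> (x q) * G (x q) else 0)" for q
    have "Ck_on k (x ` U) (\<lambda>z. (z + (- x p)) \<bullet> w)" for k
      by (intro Ck_on_inner Ck_on_add Ck_on_const Ck_on_bounded_linear bounded_linear_ident chart_open(2)[OF ch])
    then have "Cinf_on (x ` U) G"
      by (simp add: Cinf_on_def G_def[abs_def])
    then have f: "f \<in> smooth_funs A"
      using \<beta>(3) by (simp add: f_def[abs_def])
    have "(\<beta> has_derivative frechet_derivative \<beta> (at (x p))) (at (x p))"
      using Cinf_on_differentiable[OF \<beta>(1)] by (simp add: frechet_derivative_works)
    moreover have "(G has_derivative (\<lambda>v. v \<bullet> w)) (at (x p))"
      unfolding G_def by (auto intro!: derivative_eq_intros)
    ultimately have "((\<lambda>z. \<beta> z * G z) has_derivative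
        (\<lambda>v. \<beta> (x p) * (v \<bullet> w) + frechet_derivative \<beta> (at (x p)) v * G (x p))) (at (x p))"
      by (rule has_derivative_mult)
    from frechet_derivative_at[OF this]
    have "frechet_derivative (\<lambda>z. \<beta> z * G z) (at (x p)) w = \<beta> (x p) * (w \<bullet> w)"
      by (rule fun_cong[THEN trans, OF sym]) (simp add: G_def)
    moreover have "frechet_derivative (f \<circ> inv_into U x) (at (x p)) =
        frechet_derivative (\<lambda>z. \<beta> z * G z) (at (x p))"
      by (rule frechet_derivative_cong_open[OF chart_open(2)[OF ch]])
        (use c(2) chart_inv_into[OF ch] in \<open>auto simp: f_def\<close>)
    ultimately have "\<beta> (x p) * (w \<bullet> w) = 0"
      using fun_cong[OF w, of f] f by (simp add: chart_tvec_def)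
    then show "w = 0"
      using \<beta>(2) by simp
  qed
  then show ?thesis
    using linear_injective_0[OF linear_chart_tvec[OF A c]] by blast
qed

text \<open>The coordinate vectors of a chart form a basis. The dimension enters later as the trace
  of the identity.\<close>

lemma dim_tangent_space:
  fixes A :: "('a::{t2_space, second_countable_topology}, 'n::finite) chart set"
  assumes A: "smooth_atlas A"
  shows "dim (tangent_space A p) = mdim A"
proof -
  obtain U x where c: "(U, x) \<in> A" "p \<in> U"
    using atlas_covers[OF A] .
  let ?e = "chart_tvec A (U, x) p"
  note lin = linear_chart_tvec[OF A c] and inj = inj_chart_tvec[OF A c]
  show ?thesis
  proof (rule dim_unique)
    show "?e ` Basis \<subseteq> tangent_space A p" "tangent_space A p \<subseteq> span (?e ` Basis)"
      using tangent_space_chart[OF A c] by (auto simp: linear_span_image[OF lin])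
    show "independent (?e ` Basis)"
      using linear_independent_injective_image[OF lin independent_Basis] inj by simp
    show "card (?e ` Basis) = mdim A"
      using card_image[OF inj_on_subset[OF inj subset_UNIV], of Basis] by (simp add: mdim_def)
  qed
qed


section \<open>The Levi-Civita connection\<close>

locale levi_civita_manifold =
  fixes A :: "('a::{t2_space, second_countable_topology}, 'n::finite) chart set"
    and g :: "'a metric" and D :: "'a connection"
  assumes manifold: "riemannian_manifold A g" and levi_civita: "levi_civita A g D"
begin

abbreviation "\<XX> \<equiv> vector_fields A"
abbreviation "R \<equiv> curvature D"

lemma atlas: "smooth_atlas A"
  using manifold by (simp add: riemannian_manifold_def)

lemmas field_closed [simp] =
  vector_fields_add[OF atlas] vector_fields_diff[OF atlas] vector_fields_zero[OF atlas]
  vector_fields_scaleR[OF atlas] vector_fields_fmult[OF atlas]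

lemma connection_closed [simp]: "X \<in> \<XX> \<Longrightarrow> Y \<in> \<XX> \<Longrightarrow> D X Y \<in> \<XX>"
  and connection_add_left: "X \<in> \<XX> \<Longrightarrow> Y \<in> \<XX> \<Longrightarrow> Z \<in> \<XX> \<Longrightarrow> D (X + Y) Z = D X Z + D Y Z"
  and connection_add_right: "X \<in> \<XX> \<Longrightarrow> Y \<in> \<XX> \<Longrightarrow> Z \<in> \<XX> \<Longrightarrow> D X (Y + Z) = D X Y + D X Z"
  and connection_fmult_right: "f \<in> smooth_funs A \<Longrightarrow> X \<in> \<XX> \<Longrightarrow> Y \<in> \<XX> \<Longrightarrow>
    D X (f \<odot> Y) = deriv_along X f \<odot> Y + f \<odot> D X Y"
  using levi_civita by (auto simp: levi_civita_def linear_connection_def)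

lemma torsion_free: "X \<in> \<XX> \<Longrightarrow> Y \<in> \<XX> \<Longrightarrow> lie_bracket X Y = D X Y - D Y X"
  using levi_civita by (auto simp: levi_civita_def)

lemma metric_compatible: "X \<in> \<XX> \<Longrightarrow> Y \<in> \<XX> \<Longrightarrow> Z \<in> \<XX> \<Longrightarrow>
    deriv_along X (metric_app g Y Z) = metric_app g (D X Y) Z + metric_app g Y (D X Z)"
  using levi_civita by (auto simp: levi_civita_def)

lemma bracket_closed [simp]: "X \<in> \<XX> \<Longrightarrow> Y \<in> \<XX> \<Longrightarrow> lie_bracket X Y \<in> \<XX>"
  by (simp add: torsion_free)

lemma curvature_closed [simp]: "X \<in> \<XX> \<Longrightarrow> Y \<in> \<XX> \<Longrightarrow> Z \<in> \<XX> \<Longrightarrow> R X Y Z \<in> \<XX>"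
  by (simp add: curvature_def)

lemma connection_zero_left [simp]: "Z \<in> \<XX> \<Longrightarrow> D 0 Z = 0"
  using connection_add_left[of 0 0 Z] by simp

lemma connection_zero_right [simp]: "X \<in> \<XX> \<Longrightarrow> D X 0 = 0"
  using connection_add_right[of X 0 0] by simp

lemma connection_diff_left: "X \<in> \<XX> \<Longrightarrow> Y \<in> \<XX> \<Longrightarrow> Z \<in> \<XX> \<Longrightarrow> D (X - Y) Z = D X Z - D Y Z"
  using connection_add_left[of "X - Y" Y Z] by (simp add: algebra_simps)

lemma connection_diff_right: "X \<in> \<XX> \<Longrightarrow> Y \<in> \<XX> \<Longrightarrow> Z \<in> \<XX> \<Longrightarrow> D X (Y - Z) = D X Y - D X Z"
  using connection_add_right[of X "Y - Z" Z] by (simp add: algebra_simps)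

lemma metric_smooth [simp]: "X \<in> \<XX> \<Longrightarrow> Y \<in> \<XX> \<Longrightarrow> metric_app g X Y \<in> smooth_funs A"
  using manifold by (simp add: riemannian_manifold_def riemannian_metric_def)

lemma metric_linear_left:
  assumes "u \<in> tangent_space A p" "v \<in> tangent_space A p" "w \<in> tangent_space A p"
  shows "g p (a *\<^sub>R u + b *\<^sub>R v) w = a * g p u w + b * g p v w"
  using manifold assms by (simp add: riemannian_manifold_def riemannian_metric_def)

lemma metric_sym:
  assumes "u \<in> tangent_space A p" "v \<in> tangent_space A p"
  shows "g p u v = g p v u"
  using manifold assms by (simp add: riemannian_manifold_def riemannian_metric_def)

lemma metric_definite:
  assumes "u \<in> tangent_space A p" "g p u u = 0"
  shows "u = 0"
proof -
  have "u \<noteq> 0 \<longrightarrow> g p u u > 0"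
    using manifold assms(1) by (simp add: riemannian_manifold_def riemannian_metric_def)
  then show ?thesis
    using assms(2) by auto
qed

lemma metric_app_sym: "X \<in> \<XX> \<Longrightarrow> Y \<in> \<XX> \<Longrightarrow> metric_app g X Y = metric_app g Y X"
  by (auto simp: metric_app_def intro!: metric_sym vector_fields_tangent)

lemma metric_app_add_left:
  "X \<in> \<XX> \<Longrightarrow> Y \<in> \<XX> \<Longrightarrow> Z \<in> \<XX> \<Longrightarrow> metric_app g (X + Y) Z = metric_app g X Z + metric_app g Y Z"
  using metric_linear_left[of "X p" p "Y p" "Z p" 1 1 for p]
  by (simp add: fun_eq_iff metric_app_def vector_fields_tangent)

lemma metric_app_zero_left: "X \<in> \<XX> \<Longrightarrow> metric_app g 0 X = 0"
  using metric_app_add_left[of 0 0 X] by simp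

lemma metric_app_diff_left:
  "X \<in> \<XX> \<Longrightarrow> Y \<in> \<XX> \<Longrightarrow> Z \<in> \<XX> \<Longrightarrow> metric_app g (X - Y) Z = metric_app g X Z - metric_app g Y Z"
  using metric_linear_left[of "X p" p "Y p" "Z p" 1 "-1" for p]
  by (simp add: fun_eq_iff metric_app_def vector_fields_tangent)

lemma metric_app_fmult_left:
  "X \<in> \<XX> \<Longrightarrow> Z \<in> \<XX> \<Longrightarrow> metric_app g (f \<odot> X) Z = f * metric_app g X Z"
  using metric_linear_left[of "X p" p "X p" "Z p" "f p" 0 for p]
  by (simp add: fun_eq_iff metric_app_def vector_fields_tangent fmult_def)

section \<open>Symmetries of the Levi-Civita curvature\<close>

lemma curvature_skew:
  assumes "X \<in> \<XX>" "Y \<in> \<XX>" "Z \<in> \<XX>"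
  shows "R X Y Z = - R Y X Z"
  using assms by (simp add: curvature_def torsion_free connection_diff_left algebra_simps)

lemma field_linear:
  assumes "X \<in> \<XX>" "f \<in> smooth_funs A" "h \<in> smooth_funs A"
  shows "X p (f + h) = X p f + X p h" "X p (f - h) = X p f - X p h"
    "X p (\<lambda>q. c * f q) = c * X p f"
  using tangent_vector_linear[OF atlas vector_fields_tangent[OF assms(1)] assms(2,3), of p 1 1]
    tangent_vector_linear[OF atlas vector_fields_tangent[OF assms(1)] assms(2,3), of p 1 "-1"]
    tangent_vector_linear[OF atlas vector_fields_tangent[OF assms(1)] assms(2,3), of p c 0]
  by (simp_all add: plus_fun_def fun_diff_def)

lemma bracket_apply:
  "lie_bracket X Y p f = X p (deriv_along Y f) - Y p (deriv_along X f)"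
  by (simp add: lie_bracket_def)

text \<open>Differentiate the function g(Z,W) along Y and X in both orders. The difference is its
  derivative along [X,Y], and the mixed terms such as g(D Y Z, D X W) cancel, which leaves the two
  curvature terms with sum zero.\<close>

lemma curvature_metric_skew:
  assumes "X \<in> \<XX>" "Y \<in> \<XX>" "Z \<in> \<XX>" "W \<in> \<XX>"
  shows "metric_app g (R X Y Z) W p = - metric_app g (R X Y W) Z p"
proof -
  have second: "X p (deriv_along Y (metric_app g Z W)) =
      metric_app g (D X (D Y Z)) W p + metric_app g (D Y Z) (D X W) p +
      metric_app g (D X Z) (D Y W) p + metric_app g Z (D X (D Y W)) p"
    if "X \<in> \<XX>" "Y \<in> \<XX>" for X Y
  proof -
    have "X p (deriv_along Y (metric_app g Z W)) =
        deriv_along X (metric_app g (D Y Z) W) p + deriv_along X (metric_app g Z (D Y W)) p"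
      unfolding metric_compatible[OF that(2) assms(3,4)]
      using that assms by (simp add: field_linear(1) deriv_along_def)
    then show ?thesis
      using that assms by (simp add: metric_compatible)
  qed
  have "X p (deriv_along Y (metric_app g Z W)) - Y p (deriv_along X (metric_app g Z W)) =
      metric_app g (D (lie_bracket X Y) Z) W p + metric_app g Z (D (lie_bracket X Y) W) p"
    using fun_cong[OF metric_compatible[of "lie_bracket X Y" Z W], of p] assms
    by (simp add: deriv_along_def[of "lie_bracket X Y"] bracket_apply)
  moreover have "metric_app g (R X Y Z) W p = metric_app g (D X (D Y Z)) W p
      - metric_app g (D Y (D X Z)) W p - metric_app g (D (lie_bracket X Y) Z) W p"
    using assms by (simp add: curvature_def metric_app_diff_left)
  moreover have "metric_app g (R X Y W) Z p = metric_app g Z (D X (D Y W)) p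
      - metric_app g Z (D Y (D X W)) p - metric_app g Z (D (lie_bracket X Y) W) p"
    using assms by (simp add: curvature_def metric_app_diff_left metric_app_sym[of Z])
  ultimately show ?thesis
    using second[OF assms(1,2)] second[OF assms(2,1)] assms
      metric_app_sym[of "D Y Z" "D X W"] metric_app_sym[of "D X Z" "D Y W"] by simp
qed

lemma jacobi:
  assumes "X \<in> \<XX>" "Y \<in> \<XX>" "Z \<in> \<XX>"
  shows "lie_bracket X (lie_bracket Y Z) + lie_bracket Y (lie_bracket Z X) + lie_bracket Z (lie_bracket X Y) = 0"
proof (intro ext)
  fix p f
  let ?L = "lie_bracket X (lie_bracket Y Z) + lie_bracket Y (lie_bracket Z X) + lie_bracket Z (lie_bracket X Y)"
  have L: "?L \<in> \<XX>"
    using assms by simp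
  show "?L p f = (0 :: 'a vfield) p f"
  proof (cases "f \<in> smooth_funs A")
    case True
    have d: "deriv_along (lie_bracket V W) f = deriv_along V (deriv_along W f) - deriv_along W (deriv_along V f)" for V W
      by (auto simp: deriv_along_def lie_bracket_def)
    show ?thesis
      using assms True vector_fields_smooth[of _ A]
      by (simp add: bracket_apply d field_linear(2))
  next
    \<comment> \<open>A tangent vector is 0 on functions that are not smooth, by convention, and
      \<open>?L\<close> is a vector field.\<close>
    case False
    then show ?thesis
      using tangent_vector_nonsmooth[OF vector_fields_tangent[OF L] False] by simp
  qed
qed

text \<open>Torsion-freeness turns the cyclic sum of curvatures into the cyclic sum of double
  brackets, which is zero by the Jacobi identity.\<close>

lemma bianchi:
  assumes "X \<in> \<XX>" "Y \<in> \<XX>" "Z \<in> \<XX>"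
  shows "R X Y Z + R Y Z X + R Z X Y = 0"
proof -
  have br: "lie_bracket V (lie_bracket W T) = D V (D W T) - D V (D T W) - D (lie_bracket W T) V"
    if "V \<in> \<XX>" "W \<in> \<XX>" "T \<in> \<XX>" for V W T
    using that by (simp add: torsion_free[of V "lie_bracket W T"]) (simp add: torsion_free connection_diff_right)
  have "R X Y Z + R Y Z X + R Z X Y =
      lie_bracket X (lie_bracket Y Z) + lie_bracket Y (lie_bracket Z X) + lie_bracket Z (lie_bracket X Y)"
    using assms by (simp add: br curvature_def)
  then show ?thesis
    using jacobi[OF assms] by simp
qed

lemma curvature_pair_symmetry:
  assumes "X \<in> \<XX>" "Y \<in> \<XX>" "Z \<in> \<XX>" "W \<in> \<XX>"
  shows "metric_app g (R X Y Z) W p = metric_app g (R Z W X) Y p"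
proof -
  let ?r = "\<lambda>X Y Z W. metric_app g (R X Y Z) W p"
  have cyc: "?r X Y Z W + ?r Y Z X W + ?r Z X Y W = 0"
    if "X \<in> \<XX>" "Y \<in> \<XX>" "Z \<in> \<XX>" "W \<in> \<XX>" for X Y Z W
  proof -
    have "?r X Y Z W + ?r Y Z X W + ?r Z X Y W = metric_app g (R X Y Z + R Y Z X + R Z X Y) W p"
      using that by (simp add: metric_app_add_left)
    also have "\<dots> = metric_app g 0 W p"
      using bianchi[OF that(1-3)] by simp
    also have "\<dots> = 0"
      using metric_app_add_left[of 0 0 W] that(4) by (simp add: fun_eq_iff)
    finally show ?thesis .
  qed
  have sk: "?r X Y Z W = - ?r Y X Z W" if "X \<in> \<XX>" "Y \<in> \<XX>" "Z \<in> \<XX>" "W \<in> \<XX>" for X Y Z W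
    using metric_app_diff_left[of 0 "R Y X Z" W] metric_app_add_left[of 0 0 W] that
    by (simp add: curvature_skew[of X Y Z])
  note ms = curvature_metric_skew[where p = p]
  have "?r Y Z W X = - ?r Y Z X W" "?r Z W Y X = - ?r Z W X Y" "?r W Y Z X = - ?r Y W Z X"
    "?r W X Y Z = - ?r X W Y Z" "?r X Y W Z = - ?r X Y Z W" "?r Y W X Z = - ?r Y W Z X"
    using assms ms[of Y Z W X] ms[of Z W Y X] sk[of W Y Z X] sk[of W X Y Z] ms[of X Y W Z] ms[of Y W X Z]
    by blast+
  moreover have "?r W X Z Y = ?r X W Y Z" "?r X Z W Y = ?r Z X Y W"
    using sk[of W X Z Y] ms[of X W Z Y] sk[of X Z W Y] ms[of Z X W Y] assms by linarith+
  \<comment> \<open>With the skew symmetries, adding the first two cyclic identities and subtracting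
    the last two leaves twice the difference of the two sides of the claim.\<close>
  ultimately show ?thesis
    using cyc[OF assms] cyc[OF assms(2-4,1)] cyc[OF assms(3,4,1,2)] cyc[OF assms(4,1-3)]
    by linarith
qed

end


section \<open>Traces and the Ricci tensor\<close>

text \<open>The basis chosen in \<open>trace_on\<close> depends on \<open>T\<close> alone, so a
  single \<open>B\<close> computes the traces of all maps and traces can be compared term by
  term.\<close>

lemma trace_on_basis:
  obtains B where "B \<subseteq> T" "independent B" "T \<subseteq> span B"
    "\<And>L. trace_on T L = (\<Sum>b\<in>B. representation B (L b) b)"
proof -
  let ?P = "\<lambda>B. B \<subseteq> T \<and> independent B \<and> T \<subseteq> span B"
  have "\<exists>B. ?P B"
    using maximal_independent_subset[of T] by metis
  then have "?P (SOME B. ?P B)"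
    by (rule someI_ex)
  then show ?thesis
    using that[of "SOME B. ?P B"] by (simp add: trace_on_def Let_def)
qed

lemma trace_on_cong:
  assumes "\<And>v. v \<in> T \<Longrightarrow> L v = L' v"
  shows "trace_on T L = trace_on T L'"
proof -
  obtain B where B: "B \<subseteq> T" "\<And>L. trace_on T L = (\<Sum>b\<in>B. representation B (L b) b)"
    using trace_on_basis[of T] by metis
  show ?thesis
    unfolding B(2) using B(1) assms by (intro sum.cong) auto
qed

lemma trace_on_zero: "trace_on T (\<lambda>v. 0) = 0"
proof -
  obtain B where "\<And>L. trace_on T L = (\<Sum>b\<in>B. representation B (L b) b)"
    using trace_on_basis[of T] by metis
  then show ?thesis
    by (simp add: representation_zero)
qed

text \<open>The identity contributes the dimension. The rank-one map sending v to l(v) u has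
  diagonal entries u_b l(b), whose sum is l(u) by linearity. Linearity of \<open>l\<close> is asked
  on \<open>T\<close> only, as a metric is linear just on tangent spaces.\<close>

lemma trace_on_scale_minus_rank_one:
  assumes T: "subspace T" "dim T > 0" and u: "u \<in> T"
    and l: "\<And>v w a b. v \<in> T \<Longrightarrow> w \<in> T \<Longrightarrow> l (a *\<^sub>R v + b *\<^sub>R w) = a * l v + b * l w"
  shows "trace_on T (\<lambda>v. c *\<^sub>R v - l v *\<^sub>R u) = c * real (dim T) - l u"
proof -
  obtain B where B: "B \<subseteq> T" "independent B" "T \<subseteq> span B"
      and tr: "\<And>L. trace_on T L = (\<Sum>b\<in>B. representation B (L b) b)"
    using trace_on_basis[of T] by metis
  have card: "card B = dim T"
    using B by (intro basis_card_eq_dim)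
  \<comment> \<open>An infinite set has cardinality 0, so positive dimension forces
    finiteness.\<close>
  then have fin: "finite B"
    using T(2) by (intro card_ge_0_finite) simp
  have l0: "l 0 = 0"
    using l[OF u u, of 0 0] by simp
  have lsum: "l (\<Sum>b\<in>S. k b *\<^sub>R b) = (\<Sum>b\<in>S. k b * l b)" if "finite S" "S \<subseteq> T" for S k
    using that
  proof (induction S rule: finite_induct)
    case (insert b S)
    have "(\<Sum>b\<in>S. k b *\<^sub>R b) \<in> T"
      using insert.prems by (intro subspace_sum T subspace_mul) auto
    then show ?case
      using l[of b "\<Sum>b\<in>S. k b *\<^sub>R b" "k b" 1] insert by simp
  qed (simp add: l0)
  have uB: "u \<in> span B"
    using u B by auto
  have "representation B (c *\<^sub>R b - l b *\<^sub>R u) b = c - representation B u b * l b" if "b \<in> B" for b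
  proof -
    have b: "b \<in> span B"
      using that by (rule span_base)
    show ?thesis
      using that b uB B(2)
      by (simp add: representation_diff representation_scale representation_basis span_mul)
  qed
  then have "trace_on T (\<lambda>v. c *\<^sub>R v - l v *\<^sub>R u) = (\<Sum>b\<in>B. c - representation B u b * l b)"
    unfolding tr by (intro sum.cong) auto
  also have "\<dots> = c * real (dim T) - l (\<Sum>b\<in>B. representation B u b *\<^sub>R b)"
    using fin B(1) by (simp add: sum_subtractf lsum card)
  also have "(\<Sum>b\<in>B. representation B u b *\<^sub>R b) = u"
    using sum_representation_eq[OF B(2) uB fin] by simp
  finally show ?thesis .
qed

text \<open>The field chosen in \<open>at_point\<close> does not depend on \<open>F\<close>, so the
  same \<open>X\<close> evaluates every map at \<open>v\<close>. Identities between curvatures of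
  fields thereby pass to traces directly.\<close>

lemma at_point_eq:
  fixes A :: "('a::{t2_space, second_countable_topology}, 'n::finite) chart set"
  assumes "smooth_atlas A" "v \<in> tangent_space A p"
  obtains X where "X \<in> vector_fields A" "X p = v" "\<And>F. at_point A p F v = F X p"
proof -
  let ?X = "SOME X. X \<in> vector_fields A \<and> X p = v"
  have "\<exists>X. X \<in> vector_fields A \<and> X p = v"
    using tangent_vector_extends[OF assms] by blast
  then have "?X \<in> vector_fields A \<and> ?X p = v"
    by (rule someI_ex)
  then show ?thesis
    using that[of ?X] by (simp add: at_point_def)
qed

lemma ricci_eq_trace:
  fixes A :: "('a::{t2_space, second_countable_topology}, 'n::finite) chart set"
  assumes "smooth_atlas A" "\<And>X. X \<in> vector_fields A \<Longrightarrow> curvature D X Y Z p = L (X p)"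
  shows "ricci A D Y Z p = trace_on (tangent_space A p) L"
  unfolding ricci_def
proof (rule trace_on_cong)
  fix v assume "v \<in> tangent_space A p"
  then obtain X where "X \<in> vector_fields A" "X p = v"
      "at_point A p (\<lambda>X. curvature D X Y Z) v = curvature D X Y Z p"
    using at_point_eq[OF assms(1)] by metis
  then show "at_point A p (\<lambda>X. curvature D X Y Z) v = L v"
    using assms(2) by simp
qed

lemma ricci_cong:
  fixes A :: "('a::{t2_space, second_countable_topology}, 'n::finite) chart set"
  assumes "smooth_atlas A"
    and "\<And>X. X \<in> vector_fields A \<Longrightarrow> curvature D X Y Z p = curvature D' X Y' Z' p"
  shows "ricci A D Y Z p = ricci A D' Y' Z' p"
  unfolding ricci_def
proof (rule trace_on_cong)
  fix v assume "v \<in> tangent_space A p"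
  then obtain X where "X \<in> vector_fields A" "\<And>F. at_point A p F v = F X p"
    using at_point_eq[OF assms(1)] by metis
  then show "at_point A p (\<lambda>X. curvature D X Y Z) v = at_point A p (\<lambda>X. curvature D' X Y' Z') v"
    using assms(2) by simp
qed

section \<open>The projective semi-symmetric connection of a parallel unit field\<close>

locale parallel_unit_field = levi_civita_manifold A g D
  for A :: "('a::{t2_space, second_countable_topology}, 'n::finite) chart set"
    and g :: "'a metric" and D :: "'a connection" +
  fixes \<xi> :: "'a vfield"
  assumes unit: "unit_field A g \<xi>" and parallel: "parallel_field A D \<xi>"
begin

section \<open>Consequences of \<xi> being parallel\<close>

abbreviation form :: "'a vfield \<Rightarrow> 'a \<Rightarrow> real" ("\<pi>")
  where "\<pi> X \<equiv> metric_app g X \<xi>"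

lemma unit_closed [simp]: "\<xi> \<in> \<XX>"
  and form_unit: "\<pi> \<xi> p = 1"
  using unit by (auto simp: unit_field_def)

lemma connection_unit: "X \<in> \<XX> \<Longrightarrow> D X \<xi> = 0"
  using parallel by (simp add: parallel_field_def)

lemma curvature_unit: "X \<in> \<XX> \<Longrightarrow> Y \<in> \<XX> \<Longrightarrow> R X Y \<xi> = 0"
  by (simp add: curvature_def connection_unit)

text \<open>Pair symmetry moves \<xi> to the last slot and metric skewness moves it into the
  curvature, where it gives zero. Pairing \<open>R X \<xi> Z\<close> with itself then allows
  definiteness to conclude.\<close>

lemma curvature_unit_middle:
  assumes "X \<in> \<XX>" "Z \<in> \<XX>"
  shows "R X \<xi> Z = 0"
proof
  fix p
  have "metric_app g (R X \<xi> Z) (R X \<xi> Z) p = metric_app g (R Z (R X \<xi> Z) X) \<xi> p"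
    using assms by (intro curvature_pair_symmetry) auto
  also have "\<dots> = - metric_app g (R Z (R X \<xi> Z) \<xi>) X p"
    using assms by (intro curvature_metric_skew) auto
  also have "\<dots> = 0"
    using assms by (simp add: curvature_unit metric_app_zero_left)
  finally show "R X \<xi> Z p = 0 p"
    using metric_definite[OF vector_fields_tangent[of "R X \<xi> Z" A p]] assms
    by (simp add: metric_app_def)
qed

lemma deriv_form:
  assumes "X \<in> \<XX>" "Y \<in> \<XX>"
  shows "deriv_along X (\<lambda>p. c * \<pi> Y p) = (\<lambda>p. c * \<pi> (D X Y) p)"
proof
  fix p
  have "deriv_along X (\<lambda>p. c * \<pi> Y p) p = c * deriv_along X (\<pi> Y) p"
    using assms field_linear(3)[of X "\<pi> Y" "\<pi> Y" p c] by (simp add: deriv_along_def)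
  also have "deriv_along X (\<pi> Y) p = \<pi> (D X Y) p"
    using assms metric_app_sym[of Y 0] by (simp add: metric_compatible connection_unit metric_app_zero_left)
  finally show "deriv_along X (\<lambda>p. c * \<pi> Y p) p = c * \<pi> (D X Y) p" .
qed

lemma form_smooth [simp]: "X \<in> \<XX> \<Longrightarrow> (\<lambda>p. c * \<pi> X p) \<in> smooth_funs A"
  by (simp add: smooth_funs_cmult atlas)

text \<open>Here \<open>a\<close> stands for the coefficient of \<pi> in \<psi> + \<phi> and
  \<open>b\<close> for that in \<psi> - \<phi>. Keeping both as parameters shows which of them the
  curvature sees.\<close>

definition semisym :: "real \<Rightarrow> real \<Rightarrow> 'a connection" where
  "semisym a b X Y = D X Y + (\<lambda>p. a * \<pi> Y p) \<odot> X + (\<lambda>p. b * \<pi> X p) \<odot> Y"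

lemma semisym_closed [simp]: "X \<in> \<XX> \<Longrightarrow> Y \<in> \<XX> \<Longrightarrow> semisym a b X Y \<in> \<XX>"
  by (simp add: semisym_def)

lemma form_semisym: "X \<in> \<XX> \<Longrightarrow> Y \<in> \<XX> \<Longrightarrow> \<pi> (semisym a b X Y) p = \<pi> (D X Y) p + (a + b) * \<pi> X p * \<pi> Y p"
  by (simp add: semisym_def metric_app_add_left metric_app_fmult_left algebra_simps)

lemma semisym_semisym:
  assumes "X \<in> \<XX>" "Y \<in> \<XX>" "Z \<in> \<XX>"
  shows "semisym a b X (semisym a b Y Z) p h = D X (D Y Z) p h
    + a * \<pi> (D X Z) p * Y p h + a * \<pi> Z p * D X Y p h
    + b * \<pi> (D X Y) p * Z p h + b * \<pi> Y p * D X Z p h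
    + a * (\<pi> (D Y Z) p + (a + b) * \<pi> Y p * \<pi> Z p) * X p h
    + b * \<pi> X p * (D Y Z p h + a * \<pi> Z p * Y p h + b * \<pi> Y p * Z p h)"
proof -
  have "D X (semisym a b Y Z) = D X (D Y Z)
      + ((\<lambda>p. a * \<pi> (D X Z) p) \<odot> Y + (\<lambda>p. a * \<pi> Z p) \<odot> D X Y)
      + ((\<lambda>p. b * \<pi> (D X Y) p) \<odot> Z + (\<lambda>p. b * \<pi> Y p) \<odot> D X Z)"
    using assms by (simp add: semisym_def connection_add_right connection_fmult_right deriv_form)
  moreover have "semisym a b X (semisym a b Y Z) p h = D X (semisym a b Y Z) p h
      + a * \<pi> (semisym a b Y Z) p * X p h + b * \<pi> X p * semisym a b Y Z p h"
    by (simp add: semisym_def[of a b X] fmult_def scaleR_fun_def)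
  moreover have "semisym a b Y Z p h = D Y Z p h + a * \<pi> Z p * Y p h + b * \<pi> Y p * Z p h"
    by (simp add: semisym_def fmult_def scaleR_fun_def)
  ultimately show ?thesis
    using assms by (simp add: form_semisym fmult_def scaleR_fun_def)
qed

text \<open>As \<pi> is parallel, \<pi>([X,Y]) = \<pi>(D X Y) - \<pi>(D Y X), which cancels all
  terms with a derivative inside \<pi>. The quadratic terms in \<open>b\<^sup>2\<close> are
  symmetric in X and Y, those in \<open>a * b\<close> cancel each other, and only
  \<open>a\<^sup>2\<close> survives.\<close>

lemma curvature_semisym:
  assumes "X \<in> \<XX>" "Y \<in> \<XX>" "Z \<in> \<XX>"
  shows "curvature (semisym a b) X Y Z = R X Y Z + (\<lambda>p. a\<^sup>2 * \<pi> Z p) \<odot> (\<pi> Y \<odot> X - \<pi> X \<odot> Y)"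
proof (intro ext)
  fix p h
  have br: "lie_bracket X Y = D X Y - D Y X"
    using assms by (simp add: torsion_free)
  have "semisym a b (lie_bracket X Y) Z p h = D (lie_bracket X Y) Z p h
      + a * \<pi> Z p * (D X Y p h - D Y X p h) + b * (\<pi> (D X Y) p - \<pi> (D Y X) p) * Z p h"
    using assms by (simp add: semisym_def br metric_app_diff_left fmult_def scaleR_fun_def)
  then show "curvature (semisym a b) X Y Z p h =
      (R X Y Z + (\<lambda>p. a\<^sup>2 * \<pi> Z p) \<odot> (\<pi> Y \<odot> X - \<pi> X \<odot> Y)) p h"
    using semisym_semisym[OF assms, of a b p h] semisym_semisym[OF assms(2,1,3), of a b p h]
    by (simp add: curvature_def fmult_def scaleR_fun_def power2_eq_square algebra_simps)
qed

lemma curvature_semisym_closed [simp]: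
  "X \<in> \<XX> \<Longrightarrow> Y \<in> \<XX> \<Longrightarrow> Z \<in> \<XX> \<Longrightarrow> curvature (semisym a b) X Y Z \<in> \<XX>"
  by (simp add: curvature_semisym)

section \<open>Ricci and Weyl tensors in the directions along and orthogonal to \<xi>\<close>

lemma ricci_semisym_unit:
  assumes "Y \<in> \<XX>"
  shows "ricci A (semisym a b) Y \<xi> p = (real (mdim A) - 1) * a\<^sup>2 * \<pi> Y p"
proof -
  let ?T = "tangent_space A p"
  let ?l = "\<lambda>v. a\<^sup>2 * g p v (\<xi> p)"
  \<comment> \<open>With last argument \<xi> the Levi-Civita part drops out, and a multiple of the
    identity minus a rank-one map is left.\<close>
  have "ricci A (semisym a b) Y \<xi> p = trace_on ?T (\<lambda>v. (a\<^sup>2 * \<pi> Y p) *\<^sub>R v - ?l v *\<^sub>R Y p)"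
  proof (rule ricci_eq_trace[OF atlas])
    fix X assume X: "X \<in> \<XX>"
    then show "curvature (semisym a b) X Y \<xi> p = (a\<^sup>2 * \<pi> Y p) *\<^sub>R X p - ?l (X p) *\<^sub>R Y p"
      using assms by (simp add: curvature_semisym curvature_unit form_unit fmult_def scaleR_diff_right)
        (simp add: metric_app_def)
  qed
  also have "\<dots> = a\<^sup>2 * \<pi> Y p * real (dim ?T) - ?l (Y p)"
  proof (rule trace_on_scale_minus_rank_one)
    show "dim ?T > 0"
      by (simp add: dim_tangent_space[OF atlas] mdim_def)
    show "?l (c *\<^sub>R v + d *\<^sub>R w) = c * ?l v + d * ?l w" if "v \<in> ?T" "w \<in> ?T" for v w c d
      using metric_linear_left[OF that vector_fields_tangent[OF unit_closed]]
      by (simp add: algebra_simps)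
  qed (use assms in \<open>simp_all add: subspace_tangent_space[OF atlas] vector_fields_tangent\<close>)
  finally show ?thesis
    by (simp add: dim_tangent_space[OF atlas] metric_app_def algebra_simps)
qed

text \<open>The factor n - 1 in the Ricci tensor cancels the one in the definition of the Weyl
  tensor, so the subtracted term is exactly the curvature.\<close>

lemma weyl_semisym_unit:
  assumes "mdim A > 1" "X \<in> \<XX>" "Y \<in> \<XX>"
  shows "weyl_projective A (semisym a b) X Y \<xi> = 0"
proof
  fix p
  have "weyl_projective A (semisym a b) X Y \<xi> p = a\<^sup>2 *\<^sub>R (\<pi> Y p *\<^sub>R X p - \<pi> X p *\<^sub>R Y p)
      - (1 / (real (mdim A) - 1)) *\<^sub>R ((real (mdim A) - 1) *\<^sub>R
        (a\<^sup>2 *\<^sub>R (\<pi> Y p *\<^sub>R X p - \<pi> X p *\<^sub>R Y p)))"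
    using assms by (simp add: weyl_projective_def curvature_semisym curvature_unit form_unit ricci_semisym_unit
      fmult_def scaleR_fun_def[where 'b = "'a tvec"] scaleR_diff_right mult.assoc)
  then show "weyl_projective A (semisym a b) X Y \<xi> p = 0 p"
    using assms(1) by simp
qed

lemma ricci_semisym_orthogonal:
  assumes "Y \<in> \<XX>" "Z \<in> \<XX>" "\<pi> Z = 0"
  shows "ricci A (semisym a b) Y Z p = ricci A D Y Z p"
  using assms by (intro ricci_cong[OF atlas]) (simp add: curvature_semisym fmult_def)

lemma ricci_unit:
  assumes "Z \<in> \<XX>"
  shows "ricci A D \<xi> Z p = 0"
  using ricci_eq_trace[OF atlas, of D \<xi> Z p "\<lambda>v. 0"] assms
  by (simp add: curvature_unit_middle trace_on_zero)

text \<open>Both parts of the curvature vanish, one since \<open>R \<xi> Y Z = 0\<close>, the other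
  since \<pi>(Z) = 0. The Ricci term of the pair (\<xi>, Z) is zero too, so the only survivor is a
  multiple of \<xi>.\<close>

lemma weyl_semisym_unit_orthogonal:
  assumes "Y \<in> \<XX>" "Z \<in> \<XX>" "\<pi> Z = 0"
  shows "weyl_projective A (semisym a b) \<xi> Y Z p = - (ricci A D Y Z p / (real (mdim A) - 1)) *\<^sub>R \<xi> p"
proof -
  have "R \<xi> Y Z = 0"
    using assms curvature_skew[of \<xi> Y Z] by (simp add: curvature_unit_middle)
  then show ?thesis
    using assms by (simp add: weyl_projective_def curvature_semisym ricci_semisym_orthogonal ricci_unit
      fmult_def scaleR_fun_def[where 'b = "'a tvec"])
qed

section \<open>Evaluating the curvature condition, and conclusion\<close>

lemma ricci_orthogonal_zero:
  assumes "a \<noteq> 0" "mdim A > 1" "curvature_annihilates_weyl A (semisym a b)"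
    and "Y \<in> \<XX>" "Z \<in> \<XX>" "\<pi> Z = 0"
  shows "ricci A D Y Z p = 0"
proof -
  let ?K = "curvature (semisym a b)" and ?P = "weyl_projective A (semisym a b)"
  \<comment> \<open>The curvature operator of the pair (X, \<xi>) sends \<xi> to
    \<open>a\<^sup>2\<close> times X, so this scaling makes the image equal to
    \<open>Z\<close>.\<close>
  define X where "X = (1 / a\<^sup>2) *\<^sub>R Z"
  have X: "X \<in> \<XX>"
    using assms by (simp add: X_def)
  have "X = (\<lambda>p. 1 / a\<^sup>2) \<odot> Z"
    by (simp add: X_def fmult_def scaleR_fun_def)
  then have \<pi>X: "\<pi> X = 0"
    using assms by (simp add: metric_app_fmult_left)
  have K\<xi>: "?K X \<xi> \<xi> = Z"
    using X \<pi>X assms(1)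
    by (auto simp: curvature_semisym curvature_unit form_unit fmult_def scaleR_fun_def X_def)
  have K0: "?K X \<xi> 0 = 0"
    using X by (simp add: curvature_semisym curvature_unit_middle metric_app_zero_left fmult_def fun_eq_iff)
  \<comment> \<open>In the first three terms the Weyl tensor has last argument \<xi> and vanishes,
    so the outer curvature in the first acts on the zero field.\<close>
  have "?K X \<xi> (?P \<xi> Y \<xi>) - ?P (?K X \<xi> \<xi>) Y \<xi> - ?P \<xi> (?K X \<xi> Y) \<xi> - ?P \<xi> Y (?K X \<xi> \<xi>) = 0"
    using assms(3) X assms(4) unit_closed unfolding curvature_annihilates_weyl_def by blast
  then have "?P \<xi> Y Z = 0"
    using assms X by (simp add: K\<xi> K0 weyl_semisym_unit)
  then have "(ricci A D Y Z p / (real (mdim A) - 1)) *\<^sub>R \<xi> p = 0"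
    using weyl_semisym_unit_orthogonal[OF assms(4-6), of a b p] by simp
  moreover have "\<xi> p \<noteq> 0"
  proof
    assume "\<xi> p = 0"
    then show False
      using form_unit[of p] fun_cong[OF metric_app_zero_left[of \<xi>], of p] by (simp add: metric_app_def)
  qed
  ultimately show ?thesis
    using assms(2) by simp
qed

text \<open>Since \<open>D V (h \<odot> \<xi>)\<close> is V(h) \<xi>, the curvature is (X(Y f) - Y(X
  f) - [X,Y] f) \<xi> = 0. This disposes of the \<xi>-component of a field in the last slot.\<close>

lemma curvature_fmult_unit:
  assumes "X \<in> \<XX>" "Y \<in> \<XX>" "f \<in> smooth_funs A"
  shows "R X Y (f \<odot> \<xi>) = 0"
proof -
  have D\<xi>: "D V (h \<odot> \<xi>) = deriv_along V h \<odot> \<xi>" if "V \<in> \<XX>" "h \<in> smooth_funs A" for V h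
    using that by (simp add: connection_fmult_right connection_unit) (simp add: fmult_def fun_eq_iff)
  show ?thesis
    using assms vector_fields_smooth[of _ A]
    by (simp add: curvature_def D\<xi>)
      (auto simp: fmult_def scaleR_fun_def deriv_along_def lie_bracket_def fun_eq_iff algebra_simps)
qed

lemma ricci_zero:
  assumes "a \<noteq> 0" "mdim A > 1" "curvature_annihilates_weyl A (semisym a b)" "Y \<in> \<XX>" "Z \<in> \<XX>"
  shows "ricci A D Y Z p = 0"
proof -
  \<comment> \<open>The component of \<open>Z\<close> along \<xi>. Removing it makes the field
    orthogonal to \<xi> and does not change the curvature, hence not the Ricci tensor.\<close>
  define W where "W = \<pi> Z \<odot> \<xi>"
  have W: "W \<in> \<XX>"
    using assms by (simp add: W_def)
  have "\<pi> (Z - W) = 0"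
    using assms W form_unit by (simp add: metric_app_diff_left W_def metric_app_fmult_left fun_eq_iff)
  then have "ricci A D Y (Z - W) p = 0"
    using assms W by (intro ricci_orthogonal_zero) auto
  moreover have "R X Y (Z - W) = R X Y Z" if "X \<in> \<XX>" for X
  proof -
    have "R X Y (Z - W) = R X Y Z - R X Y W"
      using that assms W by (simp add: curvature_def connection_diff_right)
    then show ?thesis
      using curvature_fmult_unit[of X Y "\<pi> Z"] that assms by (simp add: W_def)
  qed
  ultimately show ?thesis
    using ricci_cong[OF atlas, of D Y "Z - W" p D Y Z] by simp
qed

lemma proj_semisym_connection_semisym:
  "proj_semisym_connection A g D \<xi> =
    semisym (real (mdim A) / (real (mdim A) + 1)) (- 1 / (real (mdim A) + 1))"
proof (intro ext)
  fix X Y p h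
  let ?n = "real (mdim A)"
  \<comment> \<open>The coefficients of \<pi> in \<psi> + \<phi> and \<psi> - \<phi>.\<close>
  have c: "(?n - 1) / (2 * (?n + 1)) + 1 / 2 = ?n / (?n + 1)"
    "(?n - 1) / (2 * (?n + 1)) - 1 / 2 = - 1 / (?n + 1)"
    by (simp_all add: divide_simps)
  have "proj_semisym_connection A g D \<xi> X Y p h = D X Y p h
      + ((?n - 1) / (2 * (?n + 1)) + 1 / 2) * \<pi> Y p * X p h
      + ((?n - 1) / (2 * (?n + 1)) - 1 / 2) * \<pi> X p * Y p h"
    by (simp add: proj_semisym_connection_def Let_def fmult_def scaleR_fun_def algebra_simps)
  then show "proj_semisym_connection A g D \<xi> X Y p h = semisym (?n / (?n + 1)) (- 1 / (?n + 1)) X Y p h"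
    unfolding c by (simp add: semisym_def fmult_def scaleR_fun_def)
qed

end

theorem theorem5p1:
  fixes A :: "('a::{t2_space, second_countable_topology}, 'n::finite) chart set"
    and g :: "'a metric"
    and D :: "'a connection"
    and \<xi> :: "'a vfield"
  assumes "riemannian_manifold A g"
    and "mdim A > 2"
    and "levi_civita A g D"
    and "unit_field A g \<xi>"
    and "parallel_field A D \<xi>"
    and "curvature_annihilates_weyl A (proj_semisym_connection A g D \<xi>)"
  shows "\<forall>Y\<in>vector_fields A. \<forall>Z\<in>vector_fields A. \<forall>p. ricci A D Y Z p = 0"
proof -
  interpret parallel_unit_field A g D \<xi>
    using assms by unfold_locales
  show ?thesis
    \<comment> \<open>The dimension bound makes n / (n + 1) nonzero and gives n > 1.\<close>
    using ricci_zero[of "real (mdim A) / (real (mdim A) + 1)" "- 1 / (real (mdim A) + 1)"] assms(2,6)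
    by (simp add: proj_semisym_connection_semisym)
qed

end
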